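(* Let $f>1$ be an integer all of whose $t\geq 1$ distinct prime divisors are congruent to $1$ modulo $3$. Let $E_f:=\{a/b\in(\mathbb{Z}/f\mathbb{Z})^*;\ f=a^2+ab+b^2,\ \gcd(a,b)=1\}$ (a set of $2^t$ elements, each of order $3$). For any $a/b\in E_f$, let $H_3=\{1,a/b,b/a\}$ be the subgroup of order $3$ of $(\mathbb{Z}/f\mathbb{Z})^*$ it generates. Then $$\tilde S(f,H_3):=\sum_{h\in H_3}\tilde s(h,f)=\frac{\phi(f)}{12}\left(\prod_{p\mid f}\left(1+\frac1p\right)-\frac1f\right)$$ and $$M(f,H_3)=\frac{\pi^2}{6}\frac{\phi(f)}{f}\left(\prod_{p\mid f}\left(1+\frac1p\right)-\frac1f\right),$$ where the products run over the prime divisors $p$ of $f$.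
   Context: For $d>1$ and $\gcd(c,d)=1$, the Dedekind sum is $s(c,d):=\frac{1}{4d}\sum_{a=1}^{d-1}\cot\left(\frac{\pi a}{d}\right)\cot\left(\frac{\pi a c}{d}\right)$, and $s(c,1):=0$. The modified sum is $\tilde s(c,d):=\frac{1}{4d}\sum_{1\leq n\leq d-1,\ \gcd(n,d)=1}\cot\left(\frac{\pi n}{d}\right)\cot\left(\frac{\pi nc}{d}\right)$. Here $a/b$ means $ab^{-1}$ modulo $f$. For $f>2$ and a subgroup $H$ of $(\mathbb{Z}/f\mathbb{Z})^*$ not containing $-1$, let $X_f^-(H)$ be the set of Dirichlet characters $\chi$ modulo $f$ with $\chi(-1)=-1$ and $\chi$ trivial on $H$, $L(s,\chi)$ the Dirichlet $L$-function of $\chi$ (as a character modulo $f$, not necessarily primitive), and $M(f,H):=\frac{1}{\#X_f^-(H)}\sum_{\chi\in X_f^-(H)}|L(1,\chi)|^2$. $\phi$ is Euler's totient function. *)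

theory Defs
  imports
    "HOL-Analysis.Analysis"
    "HOL-Number_Theory.Number_Theory"
    "HOL-Number_Theory.Modular_Inverse"
    "HOL-Algebra.Generated_Groups"
begin

text \<open>The group \<open>(\<int>/f\<int>)\<^sup>*\<close>; its elements are the residues in \<open>{0..<f}\<close> coprime to \<open>f\<close>.\<close>

abbreviation unit_group :: "nat \<Rightarrow> int monoid" where
  "unit_group f \<equiv> units_of (residue_ring (int f))"

text \<open>The class \<open>a/b = a b\<^sup>-\<^sup>1\<close> modulo \<open>f\<close>, for \<open>b\<close> coprime to \<open>f\<close>, as a residue in \<open>{0..<f}\<close>.\<close>

definition mod_quot :: "nat \<Rightarrow> int \<Rightarrow> int \<Rightarrow> int" where
  "mod_quot f a b = (a * modular_inverse (int f) b) mod int f"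

definition E_set :: "nat \<Rightarrow> int set" where
  "E_set f = {x \<in> carrier (unit_group f).
     \<exists>a b :: int. x = mod_quot f a b \<and> int f = a^2 + a * b + b^2 \<and> coprime a b}"

text \<open>The modified Dedekind sum. It depends only on \<open>c\<close> modulo \<open>d\<close>, so it may be evaluated at
  residue classes through their representatives.\<close>

definition dedekind_sum_mod :: "int \<Rightarrow> nat \<Rightarrow> real" where
  "dedekind_sum_mod c d = 1 / (4 * real d) *
     (\<Sum>n \<in> {n. 1 \<le> n \<and> n \<le> d - 1 \<and> coprime n d}.
        cot (pi * real n / real d) * cot (pi * real n * real_of_int c / real d))"

definition S_mod :: "nat \<Rightarrow> int set \<Rightarrow> real" where
  "S_mod f H = (\<Sum>h\<in>H. dedekind_sum_mod h f)"

text \<open>Characters of \<open>(\<int>/f\<int>)\<^sup>*\<close>, extended by zero to functions on the integers.\<close>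

definition dirichlet_character :: "nat \<Rightarrow> (int \<Rightarrow> complex) \<Rightarrow> bool" where
  "dirichlet_character f \<psi> \<longleftrightarrow>
     \<psi> 1 = 1 \<and>
     (\<forall>m n. \<psi> (m * n) = \<psi> m * \<psi> n) \<and>
     (\<forall>n. \<psi> (n + int f) = \<psi> n) \<and>
     (\<forall>n. \<psi> n \<noteq> 0 \<longleftrightarrow> coprime n (int f))"

definition odd_characters :: "nat \<Rightarrow> int set \<Rightarrow> (int \<Rightarrow> complex) set" where
  "odd_characters f H =
     {\<psi>. dirichlet_character f \<psi> \<and> \<psi> (- 1) = - 1 \<and> (\<forall>h\<in>H. \<psi> h = 1)}"

text \<open>The Dirichlet series \<open>L(s,\<psi>)\<close>. For non-principal \<open>\<psi>\<close> (in particular for odd \<open>\<psi>\<close>) it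
  converges for \<open>Re s > 0\<close>, in general only conditionally, so the order of summation matters
  and \<open>suminf\<close> rather than an unordered sum is used.\<close>

definition dirichlet_L :: "complex \<Rightarrow> (int \<Rightarrow> complex) \<Rightarrow> complex" where
  "dirichlet_L s \<psi> = (\<Sum>n. \<psi> (int (Suc n)) / of_nat (Suc n) powr s)"

definition mean_square_L :: "nat \<Rightarrow> int set \<Rightarrow> real" where
  "mean_square_L f H = 1 / real (card (odd_characters f H)) *
     (\<Sum>\<psi>\<in>odd_characters f H. (norm (dirichlet_L 1 \<psi>))\<^sup>2)"

end

theory Submission
  imports Defs
begin

text \<open>
  Write $c(n) = \cot(\pi n/f)$ and let $x$ be a root of $x^2+x+1$ modulo $f$. For $n$ prime to $f$
  the angles of $n, nx, nx^2$ add up to a multiple of $\pi$, so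
  $c(n)c(nx) + c(nx)c(nx^2) + c(nx^2)c(n) = 1$; summing over $n$, the three terms contribute equally,
  which gives the modified Dedekind sum of $x$. For the trivial class one needs the sum of the
  $c(n)^2$, which follows from Parseval's identity for the sawtooth function on $\mathbb{Z}/N\mathbb{Z}$ and a
  sieve over the prime divisors of $f$. The mean square is $2\pi^2/f$ times the Dedekind sum, by
  $L(1,\psi) = \frac{\pi}{2f}\sum_n \psi(n) c(n)$ for odd $\psi$ and the orthogonality of characters.
  Finally, $E_f$ consists of the roots of $x^2+x+1$ modulo $f$: a representation
  $f = a^2+ab+b^2$ with $a \equiv xb$ is found by descent from $f$ to the cofactor
  $m = (x^2+x+1)/f$ with $x$ reduced modulo $f$.
\<close>

section \<open>Roots of $x^2+x+1$ and representations by $a^2+ab+b^2$\<close>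

text \<open>The hypothesis on the primes acts twice. It gives the units modulo each prime power
  \<open>p ^ k\<close> an element of order 3, hence exactly two roots of x^2+x+1 there; and it keeps
  3 from dividing \<open>f\<close>, so that 1 is not a root and a root generates a subgroup of order
  exactly 3. The characters are taken modulo \<open>f\<close>, primitive or not, and vanish off the
  units. All sums therefore run over n coprime to \<open>f\<close>, and the closed form for the full
  sum of squared cotangents has to be sieved. The series for L(1, \<psi>) converges only
  conditionally. It is summed over whole periods, where oddness pairs a with f - a and produces
  exactly the partial fractions of the cotangent; a separate estimate fills in the incomplete
  periods. Orthogonality over odd characters trivial on H sees both H and -H. It requires enough
  characters of the unit group, which are built by extending from subgroups one generator at a
  time.\<close>

abbreviation (input) loeschian :: "int \<Rightarrow> int \<Rightarrow> int" where
  "loeschian a b \<equiv> a^2 + a * b + b^2"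

definition cubic_roots :: "nat \<Rightarrow> int set" where
  "cubic_roots n = {x \<in> {0..<int n}. int n dvd x^2 + x + 1}"

text \<open>The congruence is part of the induction claim because the step consumes it: applied to
  the cofactor \<open>m'\<close>, it makes \<open>c - y * d\<close> a multiple of \<open>m'\<close>,
  and the quotient becomes the new \<open>b\<close>.\<close>

lemma loeschian_representation:
  fixes n :: nat and x :: int
  assumes "n > 0" "int n dvd x^2 + x + 1"
  shows "\<exists>a b. int n = loeschian a b \<and> coprime a b \<and> [a = x * b] (mod int n)"
  using assms
proof (induction n arbitrary: x rule: less_induct)
  case (less n x)
  show ?case
  proof (cases "n = 1")
    case True
    then show ?thesis by (intro exI[of _ 1] exI[of _ 0]) auto
  next
    case False
    with less.prems have n2: "int n \<ge> 2" by auto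
    define r where "r = (x mod int n)"
    \<comment> \<open>The least absolute residue: \<open>2 * \<bar>y\<bar> \<le> n\<close> forces
      y^2+y+1 < n^2 for n at least 2, so the cofactor \<open>m'\<close> is smaller than
      \<open>n\<close>.\<close>
    define y where "y = (if 2 * r < int n then r else r - int n)"
    have yx: "[y = x] (mod int n)"
      unfolding y_def r_def by (auto simp: cong_def)
    have r: "0 \<le> r" "r < int n" using n2 by (auto simp: r_def)
    have ybd: "2 * \<bar>y\<bar> \<le> int n" using r by (auto simp: y_def)
    have "[y^2 + y + 1 = x^2 + x + 1] (mod int n)"
      by (intro cong_add cong_pow yx cong_refl)
    with less.prems have "int n dvd y^2 + y + 1" by (metis cong_dvd_iff)
    then obtain m' where m': "y^2 + y + 1 = int n * m'" by (auto simp: dvd_def)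
    have pos: "y^2 + y + 1 > 0"
    proof -
      have "4 * (y^2 + y + 1) = (2*y+1)^2 + 3" by (simp add: power2_eq_square algebra_simps)
      also have "\<dots> > 0" by (simp add: add_nonneg_pos)
      finally show ?thesis by simp
    qed
    have m'pos: "m' > 0" using m' pos n2 by (metis zero_less_mult_pos of_nat_0_less_iff less.prems(1))
    have "4 * (y^2 + y + 1) \<le> int n ^ 2 + 2 * int n + 4"
    proof -
      have "(2 * \<bar>y\<bar>)^2 \<le> int n ^ 2" by (intro power_mono ybd) auto
      moreover have "2 * y \<le> int n" using ybd by auto
      ultimately show ?thesis by (simp add: power_mult_distrib)
    qed
    also have "\<dots> < 4 * (int n * int n)"
    proof -
      have "2 * int n \<le> int n * int n" using n2 by (intro mult_right_mono) auto
      then show ?thesis unfolding power2_eq_square using n2 by linarith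
    qed
    finally have "m' < int n" using m' n2 by simp
    define m where "m = nat m'"
    have m: "m < n" "m > 0" "int m = m'" using \<open>m' < int n\<close> m'pos by (auto simp: m_def)
    obtain c d where cd: "int m = loeschian c d" "[c = y * d] (mod int m)"
      using less.IH[OF m(1,2), of y] m' m by auto
    then obtain k where k: "c = y * d + m' * k" using m(3)
      by (metis cong_iff_lin cong_sym)
    \<comment> \<open>With \<omega>^2 + \<omega> + 1 = 0, the number a - b\<omega> is the quotient
      of y - \<omega>, of norm n m', by c - d\<omega>, of norm m'. Rationalising the quotient gives
      these two coordinates.\<close>
    define b where "b = k"
    define a where "a = y * b + d * int n"
    \<comment> \<open>The form $(m', 2y+1, n)$ of discriminant $-3$ represents 1 at $(k, d)$. This identity gives
      both the value of the form at \<open>(a, b)\<close> and a Bezout relation between \<open>a\<close> and \<open>b\<close>.\<close>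
    have one: "m' * k^2 + (2*y+1) * k * d + int n * d^2 = 1"
    proof -
      have "m' * (m' * k^2 + (2*y+1) * k * d + int n * d^2)
            = (m'*k)^2 + (2*y+1) * (m' * k) * d + (int n * m') * d^2"
        by (simp add: power2_eq_square algebra_simps)
      also have "\<dots> = loeschian c d"
        unfolding m'[symmetric] k by (simp add: power2_eq_square algebra_simps)
      finally show ?thesis using cd(1) m(3) m'pos by simp
    qed
    have "loeschian a b = b^2 * (y^2+y+1) + (2*y+1) * b * d * int n + d^2 * int n ^ 2"
      unfolding a_def by (simp add: power2_eq_square algebra_simps)
    also have "\<dots> = int n * (m' * k^2 + (2*y+1) * k * d + int n * d^2)"
      unfolding m' b_def by (simp add: power2_eq_square algebra_simps)
    finally have "loeschian a b = int n" using one by simp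
    moreover have "coprime a b"
    proof (rule coprimeI)
      fix g assume "g dvd a" "g dvd b"
      then have "g dvd d * a + b * (m' * b + (y+1) * d)" by simp
      also have "d * a + b * (m' * b + (y+1) * d) = 1"
        using one unfolding a_def b_def by (simp add: power2_eq_square algebra_simps)
      finally show "g dvd 1" .
    qed
    moreover have "[a = x * b] (mod int n)"
    proof -
      have "[a = y * b] (mod int n)" unfolding a_def by (simp add: cong_def)
      also have "[y * b = x * b] (mod int n)" by (intro cong_mult yx cong_refl)
      finally show ?thesis .
    qed
    ultimately show ?thesis by (metis)
  qed
qed

lemma coprime_loeschian:
  assumes "coprime a b" "n = loeschian a b"
  shows "coprime a n" "coprime b n"
proof -
  have "n = (a + b) * a + b^2" "n = (a + b) * b + a^2"
    unfolding assms(2) by (simp_all add: power2_eq_square algebra_simps)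
  moreover have "gcd a ((a + b) * a + b^2) = 1" "gcd b ((a + b) * b + a^2) = 1"
    using assms(1) unfolding gcd_add_mult
    by (simp_all add: coprime_commute[of b] flip: coprime_iff_gcd_eq_1)
  ultimately show "coprime a n" "coprime b n"
    by (simp_all add: coprime_iff_gcd_eq_1)
qed

lemma coprime_cubic_root:
  fixes x n :: int
  assumes "n dvd x^2 + x + 1"
  shows "coprime x n"
proof (rule coprimeI)
  fix g assume "g dvd x" "g dvd n"
  then have "g dvd (x^2 + x + 1) - x * (x + 1)" using assms by (meson dvd_diff dvd_mult2 dvd_trans)
  then show "g dvd 1" by (simp add: power2_eq_square algebra_simps)
qed

lemma mod_quot_cong:
  assumes "coprime b (int f)"
  shows "[mod_quot f a b * b = a] (mod int f)"
proof -
  have "[mod_quot f a b * b = a * (modular_inverse (int f) b * b)] (mod int f)"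
    unfolding mod_quot_def cong_def by (simp only: mod_mult_left_eq mult.assoc)
  also have "[a * (modular_inverse (int f) b * b) = a * 1] (mod int f)"
    by (intro cong_mult cong_refl cong_modular_inverse2 assms)
  finally show ?thesis by simp
qed

lemma mod_quot_eqI:
  assumes "f > 0" "coprime b (int f)" "x \<in> {0..<int f}" "[x * b = a] (mod int f)"
  shows "mod_quot f a b = x"
proof -
  have "[mod_quot f a b * b = x * b] (mod int f)"
    using mod_quot_cong[OF assms(2)] assms(4) cong_trans cong_sym by blast
  then have "[mod_quot f a b = x] (mod int f)"
    using assms(2) by (simp add: cong_mult_rcancel)
  moreover have "mod_quot f a b mod int f = mod_quot f a b" by (simp add: mod_quot_def)
  ultimately show ?thesis using assms(3) by (simp add: cong_def)
qed

text \<open>Modulo \<open>f\<close> the form vanishes at (a, b); since b is a unit, dividing by b^2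
  leaves the quadratic equation for a/b.\<close>

lemma mod_quot_cubic_root:
  assumes "f > 0" "int f = loeschian a b" "coprime a b"
  shows "mod_quot f a b \<in> cubic_roots f"
proof -
  let ?x = "mod_quot f a b"
  have b: "coprime b (int f)" using coprime_loeschian[OF assms(3,2)] by simp
  have "[(?x^2 + ?x + 1) * b^2 = (?x*b)^2 + (?x*b) * b + b^2] (mod int f)"
    by (simp add: cong_def power2_eq_square algebra_simps)
  also have "[(?x*b)^2 + (?x*b) * b + b^2 = a^2 + a * b + b^2] (mod int f)"
    using mod_quot_cong[OF b] by (intro cong_add cong_mult cong_pow cong_refl)
  also have "[a^2 + a * b + b^2 = 0] (mod int f)"
    unfolding assms(2)[symmetric] by (simp add: cong_def)
  finally have "int f dvd (?x^2 + ?x + 1) * b^2" by (simp add: cong_0_iff)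
  then have "int f dvd ?x^2 + ?x + 1"
    using b by (simp add: coprime_dvd_mult_left_iff coprime_commute)
  then show ?thesis using assms(1) by (auto simp: cubic_roots_def mod_quot_def)
qed

lemma carrier_unit_group:
  assumes "f > 1"
  shows "carrier (unit_group f) = {x \<in> {0..<int f}. coprime x (int f)}"
proof -
  interpret residues "int f" "residue_ring (int f)"
    using assms by unfold_locales auto
  have "x \<noteq> 0" if "coprime x (int f)" for x using that assms by (intro notI) auto
  then show ?thesis by (force simp: units_of_carrier res_units_eq order_le_less)
qed

lemma E_set_eq_cubic_roots:
  assumes "f > 1"
  shows "E_set f = cubic_roots f"
proof (intro equalityI subsetI)
  fix x assume "x \<in> E_set f"
  then show "x \<in> cubic_roots f"
    using mod_quot_cubic_root[of f] assms by (auto simp: E_set_def)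
next
  fix x assume x: "x \<in> cubic_roots f"
  then obtain a b where ab: "int f = loeschian a b" "coprime a b" "[a = x * b] (mod int f)"
    using loeschian_representation[of f x] assms by (auto simp: cubic_roots_def)
  have "mod_quot f a b = x"
    using x ab(3) coprime_loeschian[OF ab(2,1)] assms
    by (intro mod_quot_eqI) (auto simp: cubic_roots_def cong_sym)
  moreover have "x \<in> carrier (unit_group f)"
    using x coprime_cubic_root assms by (auto simp: carrier_unit_group cubic_roots_def)
  ultimately show "x \<in> E_set f" using ab by (auto simp: E_set_def)
qed

section \<open>Counting the roots of x^2+x+1 modulo f\<close>

lemma card_cubic_roots_mult:
  assumes "coprime m n" "m > 0" "n > 0"
  shows "card (cubic_roots (m * n)) = card (cubic_roots m) * card (cubic_roots n)"
proof -
  have "bij_betw (\<lambda>x. (x mod int m, x mod int n)) (cubic_roots (m * n))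
          (cubic_roots m \<times> cubic_roots n)"
  proof (rule bij_betw_imageI)
    show "inj_on (\<lambda>x. (x mod int m, x mod int n)) (cubic_roots (m * n))"
    proof (rule inj_onI)
      fix x y assume xy: "x \<in> cubic_roots (m * n)" "y \<in> cubic_roots (m * n)"
        and "(x mod int m, x mod int n) = (y mod int m, y mod int n)"
      then have "[x = y] (mod int m)" "[x = y] (mod int n)" by (auto simp: cong_def)
      then have "[x = y] (mod (int m * int n))"
        using assms(1) by (simp add: coprime_cong_mult)
      with xy show "x = y" by (simp add: cubic_roots_def cong_def)
    qed
    have root_cong: "k dvd x^2 + x + 1 \<longleftrightarrow> k dvd y^2 + y + 1" if "[x = y] (mod k)" for x y k :: int
      using that by (intro cong_dvd_iff cong_add cong_pow cong_refl)
    show "(\<lambda>x. (x mod int m, x mod int n)) ` cubic_roots (m * n) = cubic_roots m \<times> cubic_roots n"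
    proof (intro equalityI subsetI)
      fix p assume "p \<in> (\<lambda>x. (x mod int m, x mod int n)) ` cubic_roots (m * n)"
      then obtain x where x: "int m * int n dvd x^2 + x + 1" "p = (x mod int m, x mod int n)"
        by (auto simp: cubic_roots_def)
      then have "int m dvd x^2 + x + 1" "int n dvd x^2 + x + 1"
        by (auto dest: dvd_mult_left dvd_mult_right)
      then show "p \<in> cubic_roots m \<times> cubic_roots n"
        using x assms root_cong[of "x mod int m" x "int m"] root_cong[of "x mod int n" x "int n"]
        by (auto simp: cubic_roots_def)
    next
      fix p assume "p \<in> cubic_roots m \<times> cubic_roots n"
      then obtain y z where p: "p = (y, z)" "y \<in> cubic_roots m" "z \<in> cubic_roots n" by auto
      obtain w where w: "[w = y] (mod int m)" "[w = z] (mod int n)"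
        using binary_chinese_remainder_int[of "int m" "int n" y z] assms(1) by auto
      define x where "x = w mod (int m * int n)"
      have x: "[x = y] (mod int m)" "[x = z] (mod int n)"
        using w by (auto simp: x_def cong_def mod_mod_cancel)
      have "int m dvd x^2 + x + 1" "int n dvd x^2 + x + 1"
        using p root_cong[OF x(1)] root_cong[OF x(2)] by (auto simp: cubic_roots_def)
      then have "int m * int n dvd x^2 + x + 1"
        using assms(1) by (simp add: divides_mult)
      moreover have "x \<in> {0..<int (m * n)}" using assms by (auto simp: x_def)
      moreover have "x mod int m = y" "x mod int n = z"
        using x p by (auto simp: cong_def cubic_roots_def)
      ultimately show "p \<in> (\<lambda>x. (x mod int m, x mod int n)) ` cubic_roots (m * n)"
        using p by (intro image_eqI[of _ _ x]) (auto simp: cubic_roots_def)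
    qed
  qed
  then show ?thesis by (simp add: bij_betw_same_card flip: card_cartesian_product)
qed

text \<open>Since x^2+x+1 = (x-1)(x+2) + 3, a common prime divisor of x-1 and x^2+x+1 divides
  3.\<close>

lemma not_dvd_cubic_root_diff_one:
  fixes p :: nat and x :: int
  assumes "prime p" "p \<noteq> 3" "int p dvd x^2 + x + 1"
  shows "\<not> int p dvd x - 1"
proof
  assume "int p dvd x - 1"
  then have "int p dvd (x^2 + x + 1) - (x - 1) * (x + 2)" using assms(3) by (intro dvd_diff) auto
  also have "(x^2 + x + 1) - (x - 1) * (x + 2) = int 3"
    by (simp add: power2_eq_square algebra_simps)
  finally have "p dvd 3" by (simp only: int_dvd_int_iff)
  moreover have "prime (3 :: nat)" by simp
  ultimately show False using assms primes_dvd_imp_eq by blast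
qed

text \<open>Existence: a primitive root raised to a third of the totient has order 3, and it remains
  to show that the factor x-1 of x^3-1 is a unit. Uniqueness: two roots x, y satisfy q |
  (y-x)(y+x+1), and \<open>p\<close> cannot divide both factors, so y is x or its conjugate
  -1-x.\<close>

lemma card_cubic_roots_prime_power:
  fixes p :: nat
  assumes p: "prime p" "[p = 1] (mod 3)" and "k > 0"
  shows "card (cubic_roots (p ^ k)) = 2"
proof -
  define q where "q = int (p ^ k)"
  have p7: "p > 3" "odd p"
  proof -
    have "p mod 3 = 1" using p(2) by (simp add: cong_def)
    moreover have "p \<ge> 2" using p prime_ge_2_nat by blast
    ultimately show "p > 3" by presburger
    then show "odd p" using p prime_odd_nat by auto
  qed
  have pp: "prime (int p)" using p by simp
  have pk: "int p dvd q" using \<open>k > 0\<close> by (simp add: q_def)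
  have q1: "q > 1" using one_less_power[OF prime_gt_1_nat[OF p(1)] \<open>k > 0\<close>]
    by (simp add: q_def flip: of_nat_power)
  have cop: "coprime z q" if "\<not> int p dvd z" for z
    using prime_imp_coprime[OF pp that] unfolding q_def of_nat_power
    by (metis coprime_commute coprime_power_right_iff)
  obtain g where g: "residue_primroot (p ^ k) g"
    using residue_primroot_odd_prime_power_exists[OF p(1) p7(2)] \<open>k > 0\<close> by metis
  have "3 dvd p - 1" using p(2) p7 unfolding cong_def by presburger
  then have d3: "3 dvd totient (p ^ k)" using p \<open>k > 0\<close> by (simp add: totient_prime_power)
  define e where "e = totient (p ^ k) div 3"
  have e: "totient (p ^ k) = e * 3" using d3 by (simp add: e_def)
  have tpos: "totient (p ^ k) > 0" using p by (simp add: prime_gt_0_nat)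
  have og: "coprime (p ^ k) g" "ord (p ^ k) g = totient (p ^ k)"
    using g by (auto simp: residue_primroot_def)
  define x where "x = int (g ^ e)"
  have x3: "q dvd x^3 - 1"
  proof -
    have "[g ^ (e * 3) = 1] (mod p ^ k)"
      using ord_divides[of g "e*3" "p^k"] og e by simp
    then have "[int (g ^ (e * 3)) = int 1] (mod int (p ^ k))" by (simp only: cong_int_iff)
    then show ?thesis by (simp add: x_def q_def cong_iff_dvd_diff power_mult)
  qed
  have x1: "\<not> q dvd x - 1"
  proof
    assume "q dvd x - 1"
    then have "[int (g ^ e) = int 1] (mod int (p ^ k))" by (simp add: x_def q_def cong_iff_dvd_diff)
    then have "[g ^ e = 1] (mod p ^ k)" by (simp only: cong_int_iff)
    then have "totient (p ^ k) dvd e" using ord_divides[of g e "p^k"] og by simp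
    with e tpos show False by (auto dest!: dvd_imp_le)
  qed
  have fac: "x^3 - 1 = (x - 1) * (x^2 + x + 1)"
    by (simp add: power2_eq_square power3_eq_cube algebra_simps)
  \<comment> \<open>That \<open>q\<close> does not divide x-1 leaves open that \<open>p\<close>
    does. If \<open>p\<close> missed x^2+x+1, all of \<open>q\<close> would divide x-1; so
    \<open>p\<close> divides x^2+x+1, hence not x-1, and then all of \<open>q\<close> divides
    x^2+x+1.\<close>
  have "int p dvd x^2 + x + 1"
  proof (rule ccontr)
    assume "\<not> int p dvd x^2 + x + 1"
    from cop[OF this] have "q dvd x - 1" using x3 unfolding fac
      by (simp add: coprime_dvd_mult_left_iff coprime_commute)
    with x1 show False by simp
  qed
  then have "\<not> int p dvd x - 1" using not_dvd_cubic_root_diff_one[OF p(1)] p7 by simp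
  then have xroot: "q dvd x^2 + x + 1"
    using x3 cop[of "x - 1"] unfolding fac by (simp add: coprime_dvd_mult_right_iff coprime_commute)
  \<comment> \<open>The discriminant is -3: 4(z^2+z+1) - (2z+1)^2 = 3, and p > 3. So a root and its
    conjugate stay distinct modulo \<open>p\<close>.\<close>
  have disc: "\<not> int p dvd 2 * z + 1" if "int p dvd z^2 + z + 1" for z
  proof
    assume "int p dvd 2 * z + 1"
    then have "int p dvd 4 * (z^2 + z + 1) - (2 * z + 1) * (2 * z + 1)"
      using that by (intro dvd_diff dvd_mult) auto
    also have "\<dots> = int 3" by (simp add: power2_eq_square algebra_simps)
    finally have "p dvd 3" by (simp only: int_dvd_int_iff)
    then show False using p7 by (auto dest: dvd_imp_le)
  qed
  have "cubic_roots (p ^ k) = {x mod q, (- 1 - x) mod q}"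
  proof (intro equalityI subsetI)
    fix y assume "y \<in> cubic_roots (p ^ k)"
    then have y: "y \<in> {0..<q}" "q dvd y^2 + y + 1" by (auto simp: cubic_roots_def q_def)
    have "q dvd (y^2 + y + 1) - (x^2 + x + 1)" using y xroot by (intro dvd_diff)
    also have "\<dots> = (y - x) * (y + x + 1)" by (simp add: power2_eq_square algebra_simps)
    finally have prod: "q dvd (y - x) * (y + x + 1)" .
    \<comment> \<open>The two factors add up to 2y+1, which is prime to \<open>p\<close>. One of
      them is therefore coprime to \<open>q\<close>, and \<open>q\<close> divides the other.\<close>
    have "\<not> (int p dvd y - x \<and> int p dvd y + x + 1)"
    proof
      assume "int p dvd y - x \<and> int p dvd y + x + 1"
      then have "int p dvd (y - x) + (y + x + 1)" using dvd_add by blast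
      also have "(y - x) + (y + x + 1) = 2 * y + 1" by simp
      finally show False using disc[of y] y(2) pk by (meson dvd_trans)
    qed
    then have "q dvd y - x \<or> q dvd y + x + 1"
      using prod cop by (metis coprime_commute coprime_dvd_mult_left_iff coprime_dvd_mult_right_iff)
    then have "[y = x] (mod q) \<or> [y = -1 - x] (mod q)"
      by (auto simp: cong_iff_dvd_diff algebra_simps)
    then show "y \<in> {x mod q, (- 1 - x) mod q}" using y by (auto simp: cong_def)
  next
    have root_cong: "q dvd u^2 + u + 1 \<longleftrightarrow> q dvd v^2 + v + 1" if "[u = v] (mod q)" for u v :: int
      using that by (intro cong_dvd_iff cong_add cong_pow cong_refl)
    have "q dvd (-1 - x)^2 + (-1 - x) + 1" using xroot by (simp add: power2_eq_square algebra_simps)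
    fix y assume "y \<in> {x mod q, (- 1 - x) mod q}"
    then have "y \<in> {0..<q}" "[y = x] (mod q) \<or> [y = -1 - x] (mod q)" using q1 by auto
    then show "y \<in> cubic_roots (p ^ k)"
      using xroot \<open>q dvd (-1 - x)^2 + (-1 - x) + 1\<close> root_cong
      unfolding cubic_roots_def q_def by blast
  qed
  moreover have "x mod q \<noteq> (- 1 - x) mod q"
  proof
    assume "x mod q = (- 1 - x) mod q"
    then have "[x = -1 - x] (mod q)" by (simp add: cong_def)
    then have "q dvd 2 * x + 1" by (simp add: cong_iff_dvd_diff)
    then show False using disc[of x] pk xroot by (meson dvd_trans)
  qed
  ultimately show ?thesis by simp
qed

lemma card_cubic_roots:
  fixes f :: nat
  assumes "f > 0" "\<And>p :: nat. prime p \<Longrightarrow> p dvd f \<Longrightarrow> [p = 1] (mod 3)"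
  shows "card (cubic_roots f) = 2 ^ card (prime_factors f)"
  using assms
proof (induction f rule: less_induct)
  case (less f)
  show ?case
  proof (cases "f = 1")
    case True
    have "cubic_roots 1 = {0}" by (auto simp: cubic_roots_def)
    then show ?thesis using True by simp
  next
    case False
    then obtain p where p: "prime p" "p dvd f" using prime_factor_nat by blast
    define k where "k = multiplicity p f"
    have k: "k > 0" using p less.prems by (simp add: k_def prime_multiplicity_gt_zero_iff)
    obtain m where m: "f = p ^ k * m" "\<not> p dvd m"
      unfolding k_def by (rule multiplicity_decompose'[of f p]) (use p less.prems in auto)
    have m0: "m > 0" using m less.prems by (cases m) auto
    have cop: "coprime (p ^ k) m" using p m(2) by (simp add: prime_imp_coprime)
    have "m < f" using m m0 one_less_power[OF prime_gt_1_nat[OF p(1)] k] by simp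
    have "prime_factors f = insert p (prime_factors m)"
      using m(1) m0 p k by (simp add: prime_factors_product prime_factorization_prime_power prime_gt_0_nat)
    moreover have "p \<notin> prime_factors m" using m by auto
    moreover have "card (cubic_roots m) = 2 ^ card (prime_factors m)"
      using less.prems(2) m(1) by (intro less.IH \<open>m < f\<close> m0) auto
    moreover have "card (cubic_roots (p ^ k)) = 2"
      using p less.prems(2) k by (intro card_cubic_roots_prime_power) auto
    ultimately show ?thesis
      using m(1) card_cubic_roots_mult[OF cop] m0 p by (simp add: prime_gt_0_nat)
  qed
qed

section \<open>Characters of finite abelian groups\<close>

text \<open>A homomorphism from \<open>K\<close> to the nonzero complex numbers, encoded as a total
  function whose values off \<open>K\<close> are arbitrary; extending a character then means
  agreeing on the smaller set. Nonvanishing is what forces the value 1 at the identity.\<close>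

definition character_on :: "('a, 'b) monoid_scheme \<Rightarrow> 'a set \<Rightarrow> ('a \<Rightarrow> complex) \<Rightarrow> bool" where
  "character_on G K \<phi> \<longleftrightarrow>
     (\<forall>x\<in>K. \<phi> x \<noteq> 0) \<and> (\<forall>x\<in>K. \<forall>y\<in>K. \<phi> (x \<otimes>\<^bsub>G\<^esub> y) = \<phi> x * \<phi> y)"

lemma (in group) character_on_one:
  assumes "character_on G K \<phi>" "subgroup K G"
  shows "\<phi> \<one> = 1"
proof -
  have "\<one> \<in> K" using assms(2) by (rule subgroup.one_closed)
  then have "\<phi> (\<one> \<otimes> \<one>) = \<phi> \<one> * \<phi> \<one>" "\<phi> \<one> \<noteq> 0"
    using assms(1) unfolding character_on_def by blast+
  then show ?thesis by simp
qed

lemma (in group) character_on_pow: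
  assumes "character_on G K \<phi>" "subgroup K G" "x \<in> K"
  shows "\<phi> (x [^] (n::nat)) = \<phi> x ^ n"
proof (induction n)
  case 0
  then show ?case using character_on_one[OF assms(1,2)] by simp
next
  case (Suc n)
  have "x [^] n \<in> K"
  proof (induction n)
    case 0
    then show ?case using assms(2) by (simp add: subgroup.one_closed)
  next
    case (Suc n)
    then show ?case using assms by (simp add: subgroup.m_closed)
  qed
  then show ?case using assms Suc by (simp add: character_on_def)
qed

text \<open>By Lagrange, the inverse of an element of a finite group is one of its powers, so
  closure under products suffices.\<close>

lemma (in group) finite_subgroupI:
  assumes "finite (carrier G)" "K \<subseteq> carrier G" "\<one> \<in> K"
    and mult: "\<And>x y. x \<in> K \<Longrightarrow> y \<in> K \<Longrightarrow> x \<otimes> y \<in> K"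
  shows "subgroup K G"
proof (rule subgroupI)
  fix x assume x: "x \<in> K"
  have pow: "x [^] (n::nat) \<in> K" for n
    by (induction n) (use assms x in auto)
  obtain m where m: "Coset.order G = Suc m"
    using order_gt_0_iff_finite assms(1) by (metis gr0_conv_Suc)
  have "x [^] m \<otimes> x = \<one>"
    using pow_order_eq_1[of x] x assms(2) m by (auto simp: nat_pow_Suc)
  then have "inv x = x [^] m"
    using x assms(2) by (intro inv_equality) auto
  then show "inv x \<in> K" using pow by simp
qed (use assms in auto)

text \<open>Division with remainder: the remainder is again an exponent that takes \<open>g\<close>
  into \<open>K\<close>, so minimality makes it 0. Thus \<open>n\<close> is the order of
  \<open>g\<close> modulo \<open>K\<close>.\<close>

lemma (in group) least_exponent_dvd:
  fixes n m :: nat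
  assumes "subgroup K G" "g \<in> carrier G" "n > 0" "g [^] n \<in> K"
    and least: "\<And>k. 0 < k \<Longrightarrow> k < n \<Longrightarrow> g [^] k \<notin> K"
    and m: "g [^] m \<in> K"
  shows "n dvd m"
proof -
  have pow: "x [^] k \<in> K" if "x \<in> K" for x and k :: nat
    by (induction k) (use assms(1) that in \<open>auto simp: subgroup.one_closed subgroup.m_closed\<close>)
  have "g [^] m = (g [^] n) [^] (m div n) \<otimes> g [^] (m mod n)"
    using assms(2) by (simp add: nat_pow_pow nat_pow_mult)
  then have "g [^] (m mod n) = inv ((g [^] n) [^] (m div n)) \<otimes> g [^] m"
    using assms(2) by (simp add: inv_solve_left' inv_solve_left)
  also have "\<dots> \<in> K"
    using assms(1,4) m pow by (intro subgroup.m_closed subgroup.m_inv_closed) auto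
  finally have "m mod n = 0"
    using least[of "m mod n"] \<open>n > 0\<close> by auto
  then show ?thesis by auto
qed

text \<open>The only constraint on a value at \<open>g\<close> comes from \<open>g [^] n\<close>,
  the first power of \<open>g\<close> lying in \<open>K\<close>; any \<open>n\<close>-th root
  \<open>z\<close> of the value there is admissible. The free choice of \<open>z\<close> is kept in
  the statement because separating \<open>g\<close> from \<open>K\<close> depends on it.\<close>

lemma (in comm_group) extend_character_step:
  fixes n :: nat
  assumes fin: "finite (carrier G)" and K: "subgroup K G" and \<phi>: "character_on G K \<phi>"
    and g: "g \<in> carrier G" and n: "n > 0" "g [^] n \<in> K"
    and least: "\<And>k. 0 < k \<Longrightarrow> k < n \<Longrightarrow> g [^] k \<notin> K"
    and z: "z ^ n = \<phi> (g [^] n)"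
  shows "\<exists>K' \<phi>'. subgroup K' G \<and> insert g K \<subseteq> K' \<and> character_on G K' \<phi>' \<and>
    (\<forall>x\<in>K. \<phi>' x = \<phi> x) \<and> \<phi>' g = z"
proof -
  have Kc: "x \<in> carrier G" if "x \<in> K" for x using K that by (rule subgroup.mem_carrier)
  have Km: "x \<otimes> y \<in> K" if "x \<in> K" "y \<in> K" for x y using K that by (rule subgroup.m_closed)
  have K1: "\<one> \<in> K" using K by (rule subgroup.one_closed)
  have \<phi>m: "\<phi> (x \<otimes> y) = \<phi> x * \<phi> y" if "x \<in> K" "y \<in> K" for x y
    using \<phi> that by (simp add: character_on_def)
  have \<phi>0: "\<phi> x \<noteq> 0" if "x \<in> K" for x
    using \<phi> that by (simp add: character_on_def)
  have z0: "z \<noteq> 0" using z \<phi>0[OF n(2)] n(1) by (metis power_eq_0_iff zero_power)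
  have zpow: "\<phi> (g [^] m) = z ^ m" if "g [^] m \<in> K" for m :: nat
  proof -
    have "n dvd m" using least_exponent_dvd[OF K g n least that] .
    then obtain q where q: "m = n * q" by auto
    have "\<phi> (g [^] m) = \<phi> ((g [^] n) [^] q)" using g q by (simp add: nat_pow_pow)
    also have "\<dots> = \<phi> (g [^] n) ^ q" by (rule character_on_pow[OF \<phi> K n(2)])
    finally show ?thesis using z q by (simp add: power_mult)
  qed
  \<comment> \<open>Cancelling \<open>g [^] i\<close> puts \<open>g [^] (j - i)\<close> into
    \<open>K\<close>, where \<open>zpow\<close> gives the value of the character. The case of j at
    most i follows by symmetry.\<close>
  have wd': "\<phi> k * z ^ i = \<phi> l * z ^ j"
    if "k \<in> K" "l \<in> K" "k \<otimes> g [^] i = l \<otimes> g [^] j" "i \<le> j" for k l and i j :: nat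
  proof -
    have "g [^] j = g [^] (j - i) \<otimes> g [^] i" using g that(4) by (simp add: nat_pow_mult)
    then have "k \<otimes> g [^] i = (l \<otimes> g [^] (j - i)) \<otimes> g [^] i"
      using that g Kc by (simp add: m_assoc)
    then have k: "k = l \<otimes> g [^] (j - i)" using that g Kc by simp
    then have "g [^] (j - i) = inv l \<otimes> k" using that g Kc by (simp add: inv_solve_left)
    then have gk: "g [^] (j - i) \<in> K" using that K by (simp add: subgroup.m_closed subgroup.m_inv_closed)
    have "\<phi> k = \<phi> l * z ^ (j - i)" using k that gk \<phi>m zpow by simp
    then show ?thesis using that(4) by (simp flip: power_add)
  qed
  have wd: "\<phi> k * z ^ i = \<phi> l * z ^ j"
    if "k \<in> K" "l \<in> K" "k \<otimes> g [^] i = l \<otimes> g [^] j" for k l and i j :: nat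
    using wd'[of k l i j] wd'[of l k j i] that by (metis nat_le_linear)
  \<comment> \<open>Natural exponents suffice, since closure under products makes a subgroup of a
    finite group.\<close>
  define K' where "K' = {k \<otimes> g [^] i | k i. k \<in> K \<and> i \<in> (UNIV :: nat set)}"
  define \<phi>' where "\<phi>' x = (SOME v. \<exists>k i. k \<in> K \<and> x = k \<otimes> g [^] (i::nat) \<and> v = \<phi> k * z ^ i)" for x
  have \<phi>': "\<phi>' (k \<otimes> g [^] i) = \<phi> k * z ^ i" if "k \<in> K" for k and i :: nat
    unfolding \<phi>'_def
  proof (rule some_equality)
    fix v assume "\<exists>l j. l \<in> K \<and> k \<otimes> g [^] i = l \<otimes> g [^] (j::nat) \<and> v = \<phi> l * z ^ j"
    then obtain l j where "l \<in> K" "k \<otimes> g [^] i = l \<otimes> g [^] (j::nat)" "v = \<phi> l * z ^ j" by blast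
    then show "v = \<phi> k * z ^ i" using wd[OF that] by simp
  qed (use that in blast)
  have mult: "(k \<otimes> g [^] i) \<otimes> (l \<otimes> g [^] j) = (k \<otimes> l) \<otimes> g [^] (i + j)"
    if "k \<in> K" "l \<in> K" for k l and i j :: nat
    using that g Kc by (simp add: m_ac flip: nat_pow_mult)
  show ?thesis
  proof (intro exI conjI ballI)
    show "subgroup K' G"
    proof (rule finite_subgroupI[OF fin])
      show "K' \<subseteq> carrier G" using g Kc by (auto simp: K'_def)
      have "\<one> = \<one> \<otimes> g [^] (0::nat)" by simp
      then show "\<one> \<in> K'" using K1 unfolding K'_def by blast
      fix x y assume "x \<in> K'" "y \<in> K'"
      then show "x \<otimes> y \<in> K'" unfolding K'_def using mult Km by blast
    qed
    have in_K': "k \<otimes> g [^] i \<in> K'" if "k \<in> K" for k and i :: nat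
      using that by (auto simp: K'_def)
    show "insert g K \<subseteq> K'"
      using in_K'[OF K1, of 1] in_K'[of _ 0] g Kc by auto
    show "character_on G K' \<phi>'"
      unfolding character_on_def
    proof (intro conjI ballI)
      fix x assume "x \<in> K'"
      then obtain k and i :: nat where x: "x = k \<otimes> g [^] i" "k \<in> K" by (auto simp: K'_def)
      then show "\<phi>' x \<noteq> 0" using \<phi>' \<phi>0 z0 by simp
      fix y assume "y \<in> K'"
      then obtain l and j :: nat where y: "y = l \<otimes> g [^] j" "l \<in> K" by (auto simp: K'_def)
      show "\<phi>' (x \<otimes> y) = \<phi>' x * \<phi>' y"
        using x y by (simp add: mult \<phi>' Km \<phi>m power_add)
    qed
    show "\<phi>' x = \<phi> x" if "x \<in> K" for x
      using \<phi>'[OF that, of 0] Kc[OF that] by simp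
    show "\<phi>' g = z"
      using \<phi>'[OF K1, of 1] g character_on_one[OF \<phi> K] by simp
  qed
qed

lemma (in group) exists_least_exponent:
  assumes "finite (carrier G)" "subgroup K G" "g \<in> carrier G"
  shows "\<exists>n>0. g [^] n \<in> K \<and> (\<forall>k::nat. 0 < k \<longrightarrow> k < n \<longrightarrow> g [^] k \<notin> K)"
proof -
  define P where "P n \<longleftrightarrow> n > 0 \<and> g [^] n \<in> K" for n :: nat
  have "P (Coset.order G)"
    using assms pow_order_eq_1[of g] order_gt_0_iff_finite
    by (simp add: P_def subgroup.one_closed)
  then obtain n where "P n" "\<And>k. k < n \<Longrightarrow> \<not> P k"
    using exists_least_iff[of P] by blast
  then show ?thesis unfolding P_def by blast
qed

lemma (in comm_group) extend_character:
  assumes fin: "finite (carrier G)" and "subgroup K G" "character_on G K \<phi>"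
  shows "\<exists>\<psi>. character_on G (carrier G) \<psi> \<and> (\<forall>x\<in>K. \<psi> x = \<phi> x)"
  using assms(2,3)
proof (induction "card (carrier G) - card K" arbitrary: K \<phi> rule: less_induct)
  case less
  have Ksub: "K \<subseteq> carrier G" using less.prems(1) by (rule subgroup.subset)
  show ?case
  proof (cases "K = carrier G")
    case True
    then show ?thesis using less.prems by blast
  next
    case False
    then obtain g where g: "g \<in> carrier G" "g \<notin> K" using Ksub by blast
    obtain n :: nat where n: "n > 0" "g [^] n \<in> K" "\<And>k. 0 < k \<Longrightarrow> k < n \<Longrightarrow> g [^] k \<notin> K"
      using exists_least_exponent[OF fin less.prems(1) g(1)] by blast
    \<comment> \<open>An \<open>n\<close>-th root taken through the logarithm; the zero branch makes
      \<open>z ^ n\<close> correct in both cases because n > 0.\<close>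
    define z where "z = (if \<phi> (g [^] n) = 0 then 0 else exp (Ln (\<phi> (g [^] n)) / of_nat n))"
    have "z ^ n = \<phi> (g [^] n)"
      using n(1) by (simp add: z_def exp_of_nat_mult[symmetric])
    from extend_character_step[OF fin less.prems g(1) n this] obtain K' \<phi>' where
      K': "subgroup K' G" "insert g K \<subseteq> K'" "character_on G K' \<phi>'" "\<forall>x\<in>K. \<phi>' x = \<phi> x"
      by blast
    have K'sub: "K' \<subseteq> carrier G" using K'(1) by (rule subgroup.subset)
    have "card K < card K'"
      using K'(2) g K'sub fin by (intro psubset_card_mono) (auto intro: finite_subset)
    moreover have "card K' \<le> card (carrier G)" using K'sub fin by (rule card_mono[rotated])
    ultimately have "card (carrier G) - card K' < card (carrier G) - card K" by simp
    from less.hyps[OF this K'(1,3)] obtain \<psi> where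
      "character_on G (carrier G) \<psi>" "\<forall>x\<in>K'. \<psi> x = \<phi>' x" by blast
    moreover have "K \<subseteq> K'" using K'(2) by simp
    ultimately show ?thesis using K'(4) by (intro exI[of _ \<psi>]) auto
  qed
qed

text \<open>Begin with the trivial character on \<open>K\<close>. As \<open>g\<close> is outside
  \<open>K\<close>, the least exponent \<open>n\<close> is at least 2, so the primitive root of
  unity e^(2 pi i/n) is an admissible value at \<open>g\<close> and differs from 1.\<close>

lemma (in comm_group) separating_character:
  assumes fin: "finite (carrier G)" and K: "subgroup K G" and g: "g \<in> carrier G" "g \<notin> K"
  shows "\<exists>\<phi>. character_on G (carrier G) \<phi> \<and> (\<forall>x\<in>K. \<phi> x = 1) \<and> \<phi> g \<noteq> 1"
proof -
  obtain n :: nat where n: "n > 0" "g [^] n \<in> K" "\<And>k. 0 < k \<Longrightarrow> k < n \<Longrightarrow> g [^] k \<notin> K"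
    using exists_least_exponent[OF fin K g(1)] by blast
  have "n \<noteq> 1" using n(2) g by auto
  with n(1) have n2: "n \<ge> 2" by simp
  define z where "z = cis (2 * pi / n)"
  have z: "z ^ n = 1" using n(1) unfolding z_def Complex.DeMoivre by simp
  have "z \<noteq> 1"
  proof
    assume "z = 1"
    then have "cos (2 * pi / n) = 1" by (simp add: z_def complex_eq_iff)
    moreover have "2 * pi / n \<le> pi" "2 * pi / n > 0" using n2 pi_gt_zero by (auto simp: field_simps)
    ultimately show False using cos_monotone_0_pi[of 0 "2 * pi / n"] by simp
  qed
  have triv: "character_on G K (\<lambda>_. 1)" by (simp add: character_on_def)
  from extend_character_step[OF fin K triv g(1) n z] obtain K' \<phi>' where
    K': "subgroup K' G" "insert g K \<subseteq> K'" "character_on G K' \<phi>'" "\<forall>x\<in>K. \<phi>' x = 1" "\<phi>' g = z"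
    by blast
  obtain \<psi> where "character_on G (carrier G) \<psi>" "\<forall>x\<in>K'. \<psi> x = \<phi>' x"
    using extend_character[OF fin K'(1,3)] by blast
  then show ?thesis using K' \<open>z \<noteq> 1\<close> by (intro exI[of _ \<psi>]) auto
qed

section \<open>The value at 1 of the L-function of an odd character\<close>

text \<open>This is the logarithmic derivative of the reflection formula
  \<open>rGamma z * rGamma (1 - z) = sin (pi * z) / pi\<close>, obtained by differentiating both
  sides.\<close>

lemma pi_cot_eq_Digamma_diff:
  fixes z :: complex
  assumes "z \<notin> \<int>"
  shows "of_real pi * cot (of_real pi * z) = Digamma (1 - z) - Digamma z"
proof -
  have 1: "1 - z \<notin> \<int>" using assms by (metis Ints_1 Ints_diff diff_diff_eq2 add_diff_cancel_left')
  have z: "z \<notin> \<int>\<^sub>\<le>\<^sub>0" "1 - z \<notin> \<int>\<^sub>\<le>\<^sub>0" using assms 1 by auto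
  have "((\<lambda>z. rGamma z * rGamma (1 - z)) has_field_derivative
          rGamma z * rGamma (1 - z) * (Digamma (1 - z) - Digamma z)) (at z)"
    using z by (auto intro!: derivative_eq_intros simp: algebra_simps)
  moreover have "((\<lambda>z. rGamma z * rGamma (1 - z)) has_field_derivative cos (of_real pi * z)) (at z)"
    unfolding rGamma_reflection_complex by (auto intro!: derivative_eq_intros)
  ultimately have "cos (of_real pi * z) = rGamma z * rGamma (1 - z) * (Digamma (1 - z) - Digamma z)"
    using DERIV_unique by blast
  moreover have "sin (of_real pi * z) \<noteq> 0"
  proof
    assume "sin (of_real pi * z) = 0"
    then obtain n :: int where "of_real pi * z = of_real (of_int n * pi)"
      unfolding sin_eq_0 by auto
    then have "z = of_int n" by simp
    with assms show False by simp
  qed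
  ultimately show ?thesis by (simp add: rGamma_reflection_complex cot_def field_simps)
qed

text \<open>The logarithms in the limit formulas for the two Digamma values cancel. The one-sided
  pairing of z+k with 1-z+k matches the residues a and f-a within one period when z = a/f.\<close>

lemma pi_cot_partial_fractions:
  fixes z :: complex
  assumes "z \<notin> \<int>"
  shows "(\<lambda>m. \<Sum>k<m. 1 / (z + of_nat k) - 1 / (1 - z + of_nat k))
           \<longlonglongrightarrow> of_real pi * cot (of_real pi * z)"
proof -
  have "z \<noteq> 0" "1 - z \<noteq> 0" using assms by auto
  from tendsto_diff[OF Digamma_LIMSEQ[OF this(2)] Digamma_LIMSEQ[OF this(1)]]
  show ?thesis
    unfolding pi_cot_eq_Digamma_diff[OF assms]
    by (simp add: sum_subtractf inverse_eq_divide)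
qed

section \<open>Periodicity and absolute values of Dirichlet characters\<close>

lemma dirichlet_character_cong:
  assumes "dirichlet_character f \<psi>" "[m = n] (mod int f)"
  shows "\<psi> m = \<psi> n"
proof -
  have per: "\<psi> (n + int f) = \<psi> n" for n
    using assms(1) by (simp add: dirichlet_character_def)
  have nat: "\<psi> (n + int f * int k) = \<psi> n" for n k
  proof (induction k)
    case (Suc k)
    have "\<psi> (n + int f * int (Suc k)) = \<psi> ((n + int f * int k) + int f)" by (simp add: algebra_simps)
    then show ?case using per Suc by simp
  qed simp
  obtain k where k: "n = m + int f * k" using assms(2) by (auto simp: cong_iff_lin)
  show ?thesis
  proof (cases "k \<ge> 0")
    case True
    then show ?thesis using nat[of m "nat k"] k by simp
  next
    case False
    then show ?thesis using nat[of n "nat (- k)"] k by simp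
  qed
qed

lemma dirichlet_character_pow:
  assumes "dirichlet_character f \<psi>"
  shows "\<psi> (n ^ k) = \<psi> n ^ k"
  using assms by (induction k) (auto simp: dirichlet_character_def)

lemma dirichlet_character_root_of_unity:
  assumes "dirichlet_character f \<psi>" "coprime n (int f)" "f > 0"
  shows "\<psi> n ^ totient f = 1"
proof -
  let ?m = "nat (n mod int f)"
  have m: "int ?m = n mod int f" using assms(3) by simp
  have "coprime (int ?m) (int f)" unfolding m using assms(2,3) by simp
  then have "[?m ^ totient f = 1] (mod f)" by (intro euler_theorem) (simp only: coprime_int_iff)
  then have "[int (?m ^ totient f) = int 1] (mod int f)" by (simp only: cong_int_iff)
  then have "[(n mod int f) ^ totient f = 1] (mod int f)" using m by simp
  then have "[n ^ totient f = 1] (mod int f)" by (simp add: cong_def power_mod)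
  then have "\<psi> (n ^ totient f) = \<psi> 1" by (rule dirichlet_character_cong[OF assms(1)])
  then show ?thesis
    using assms(1) unfolding dirichlet_character_pow[OF assms(1)] by (simp add: dirichlet_character_def)
qed

lemma norm_dirichlet_character:
  assumes "dirichlet_character f \<psi>" "coprime n (int f)" "f > 0"
  shows "norm (\<psi> n) = 1"
proof -
  have "norm (\<psi> n) ^ totient f = 1"
    using dirichlet_character_root_of_unity[OF assms] by (simp flip: norm_power)
  then show ?thesis using power_eq_1_iff assms(3) by fastforce
qed

lemma dirichlet_character_eq_0:
  assumes "dirichlet_character f \<psi>" "\<not> coprime n (int f)"
  shows "\<psi> n = 0"
  using assms by (auto simp: dirichlet_character_def)

lemma norm_dirichlet_character_le:
  assumes "dirichlet_character f \<psi>" "f > 0"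
  shows "norm (\<psi> n) \<le> 1"
  using assms by (cases "coprime n (int f)")
    (auto simp: norm_dirichlet_character dirichlet_character_eq_0)

text \<open>After q full blocks at most \<open>f\<close> terms are left over, each of size at most
  1/(qf), so the incomplete block contributes at most 1/q. This passes from convergence along
  multiples of \<open>f\<close> to convergence of a series that need not converge
  absolutely.\<close>

lemma sums_of_blocks:
  fixes t :: "nat \<Rightarrow> 'a :: real_normed_vector"
  assumes "f > 0" "(\<lambda>m. \<Sum>n<m * f. t n) \<longlonglongrightarrow> s" "\<And>n. n > 0 \<Longrightarrow> norm (t n) \<le> 1 / real n"
  shows "t sums s"
proof -
  have lim: "filterlim (\<lambda>N. N div f) sequentially sequentially"
    using assms(1) by (intro filterlim_at_top_div_const_nat) auto
  have "(\<lambda>N. (\<Sum>n<N. t n) - (\<Sum>n<(N div f) * f. t n)) \<longlonglongrightarrow> 0"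
  proof (rule Lim_null_comparison)
    show "(\<lambda>N. 1 / real (N div f)) \<longlonglongrightarrow> 0"
      using filterlim_compose[OF lim_1_over_n lim] .
    show "\<forall>\<^sub>F N in sequentially.
        norm ((\<Sum>n<N. t n) - (\<Sum>n<(N div f) * f. t n)) \<le> 1 / real (N div f)"
    proof (rule eventually_sequentiallyI[of f])
      fix N assume "N \<ge> f"
      define q where "q = N div f"
      have q: "q > 0" using \<open>N \<ge> f\<close> assms(1) by (simp add: q_def div_greater_zero_iff)
      have qN: "q * f \<le> N" "N - q * f \<le> f"
        using assms(1) by (auto simp: q_def minus_div_mult_eq_mod less_imp_le)
      have "(\<Sum>n<N. t n) - (\<Sum>n<q * f. t n) = (\<Sum>n=q*f..<N. t n)"
        using sum_diff_nat_ivl[of 0 "q * f" N t] qN by (simp add: atLeast0LessThan)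
      also have "norm \<dots> \<le> of_nat (card {q*f..<N}) * (1 / real (q * f))"
      proof (rule sum_norm_bound)
        fix n assume n: "n \<in> {q*f..<N}"
        moreover have "q * f > 0" using q assms(1) by simp
        ultimately have npos: "n > 0" by (metis atLeastLessThan_iff less_le_trans)
        then have "norm (t n) \<le> 1 / real n" by (rule assms(3))
        also have "\<dots> \<le> 1 / real (q * f)"
          using n q assms(1) npos by (intro divide_left_mono) (auto simp flip: of_nat_mult)
        finally show "norm (t n) \<le> 1 / real (q * f)" .
      qed
      also have "\<dots> \<le> real f * (1 / real (q * f))"
        unfolding card_atLeastLessThan using qN(2) by (intro mult_right_mono) (simp only: of_nat_le_iff, simp)
      also have "\<dots> = 1 / real q" using assms(1) by simp
      finally show "norm ((\<Sum>n<N. t n) - (\<Sum>n<(N div f) * f. t n)) \<le> 1 / real (N div f)"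
        by (simp add: q_def)
    qed
  qed
  from tendsto_add[OF this filterlim_compose[OF assms(2) lim]] show ?thesis
    by (simp add: sums_def)
qed

text \<open>Averaging a block of length \<open>f\<close> with its reflection under a -> f-a turns
  it, by oddness, into half the sum of \<psi>(a) (1/(kf+a) - 1/(kf+f-a)). Summed over k this is the
  partial fraction series of the cotangent at a/f; the averaging accounts for the 2 in the factor
  and the rescaling for the \<open>f\<close>.\<close>

lemma dirichlet_L_1_odd:
  assumes \<psi>: "dirichlet_character f \<psi>" and odd: "\<psi> (- 1) = - 1" and f: "f > 1"
  shows "dirichlet_L 1 \<psi> =
           of_real (pi / (2 * real f)) * (\<Sum>a\<in>{1..<f}. \<psi> (int a) * of_real (cot (pi * real a / real f)))"
    (is "_ = ?L")
proof -
  define t where "t n = \<psi> (int n) / of_nat n" for n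
  have mult: "\<psi> (m * n) = \<psi> m * \<psi> n" for m n using \<psi> by (simp add: dirichlet_character_def)
  have neg: "\<psi> (int (f - a)) = - \<psi> (int a)" if "a \<in> {1..<f}" for a
  proof -
    have "\<psi> (int (f - a)) = \<psi> (- int a)"
      using that by (intro dirichlet_character_cong[OF \<psi>]) (auto simp: cong_iff_dvd_diff of_nat_diff)
    also have "\<dots> = \<psi> (- 1 * int a)" by simp
    finally show ?thesis using odd unfolding mult by simp
  qed
  \<comment> \<open>As f > 1, multiples of \<open>f\<close> are not units and their terms vanish;
    this includes n = 0.\<close>
  have psi0: "\<psi> (int 0) = 0" using f by (intro dirichlet_character_eq_0[OF \<psi>]) auto
  have block: "(\<Sum>n=k*f..<k*f+f. t n) = of_real (1 / (2 * real f)) * (\<Sum>a\<in>{1..<f}.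
      \<psi> (int a) * (1 / (of_nat a / of_nat f + of_nat k) - 1 / (1 - of_nat a / of_nat f + of_nat k)))" for k
  proof -
    have "(\<Sum>n=k*f..<k*f+f. t n) = (\<Sum>a<f. t (k*f + a))"
      using sum.shift_bounds_nat_ivl[of t 0 "k*f" f] by (simp add: atLeast0LessThan add.commute)
    also have "\<dots> = (\<Sum>a\<in>{1..<f}. \<psi> (int a) / of_nat (k * f + a))"
    proof (rule sum.mono_neutral_cong_right)
      have "\<psi> (int (k * f + a)) = \<psi> (int a)" for a
        by (intro dirichlet_character_cong[OF \<psi>]) (simp add: cong_def)
      then show "t (k * f + a) = \<psi> (int a) / of_nat (k * f + a)" for a
        by (simp add: t_def)
      moreover have "a = 0" if "a \<in> {..<f} - {1..<f}" for a using that by auto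
      ultimately show "\<forall>a\<in>{..<f} - {1..<f}. t (k * f + a) = 0"
        using psi0 by (metis div_0)
    qed auto
    finally have 1: "(\<Sum>n=k*f..<k*f+f. t n) = (\<Sum>a\<in>{1..<f}. \<psi> (int a) / of_nat (k * f + a))" .
    also have "\<dots> = (\<Sum>a\<in>{1..<f}. \<psi> (int (f - a)) / of_nat (k * f + (f - a)))"
      by (rule sum.reindex_bij_witness[of _ "\<lambda>a. f - a" "\<lambda>a. f - a"]) auto
    also have "\<dots> = (\<Sum>a\<in>{1..<f}. - \<psi> (int a) / of_nat (k * f + (f - a)))"
      by (intro sum.cong refl) (simp only: neg)
    finally have 2: "(\<Sum>n=k*f..<k*f+f. t n) = (\<Sum>a\<in>{1..<f}. - \<psi> (int a) / of_nat (k * f + (f - a)))" .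
    have "2 * (\<Sum>n=k*f..<k*f+f. t n) =
        (\<Sum>a\<in>{1..<f}. \<psi> (int a) / of_nat (k * f + a) + - \<psi> (int a) / of_nat (k * f + (f - a)))"
      unfolding sum.distrib 1[symmetric] 2[symmetric] by simp
    also have "\<dots> = (\<Sum>a\<in>{1..<f}. of_real (1 / real f) *
      (\<psi> (int a) * (1 / (of_nat a / of_nat f + of_nat k) - 1 / (1 - of_nat a / of_nat f + of_nat k))))"
    proof (intro sum.cong refl)
      fix a assume a: "a \<in> {1..<f}"
      have "1 / of_nat (k * f + a) = (1 / of_nat f) * (1 / (of_nat a / of_nat f + of_nat k) :: complex)"
        using f by (simp add: field_simps)
      moreover have "1 / of_nat (k * f + (f - a)) =
          (1 / of_nat f) * (1 / (1 - of_nat a / of_nat f + of_nat k) :: complex)"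
        using f a by (simp add: field_simps of_nat_diff)
      moreover have "\<psi> (int a) / of_nat (k * f + a) + - \<psi> (int a) / of_nat (k * f + (f - a))
          = \<psi> (int a) * (1 / of_nat (k * f + a) - 1 / of_nat (k * f + (f - a)))"
        by (simp add: algebra_simps)
      ultimately show "\<psi> (int a) / of_nat (k * f + a) + - \<psi> (int a) / of_nat (k * f + (f - a))
          = of_real (1 / real f) *
      (\<psi> (int a) * (1 / (of_nat a / of_nat f + of_nat k) - 1 / (1 - of_nat a / of_nat f + of_nat k)))"
        by (simp only: ) (simp add: algebra_simps)
    qed
    finally have "2 * (\<Sum>n=k*f..<k*f+f. t n) = of_real (1 / real f) * (\<Sum>a\<in>{1..<f}.
      \<psi> (int a) * (1 / (of_nat a / of_nat f + of_nat k) - 1 / (1 - of_nat a / of_nat f + of_nat k)))"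
      by (simp only: sum_distrib_left)
    moreover have "x = of_real (1 / (2 * real f)) * S" if "2 * x = of_real (1 / real f) * S" for x S :: complex
      using that f by (simp add: field_simps)
    ultimately show ?thesis by blast
  qed
  have "t sums ?L"
  proof (rule sums_of_blocks[of f])
    have nonint: "complex_of_nat a / of_nat f \<notin> \<int>" if "a \<in> {1..<f}" for a
    proof
      assume "complex_of_nat a / of_nat f \<in> \<int>"
      then obtain k where "complex_of_nat a / of_nat f = of_int k" by (elim Ints_cases)
      then have "complex_of_int (int a) = of_int (k * int f)" using f by (simp add: field_simps)
      then have "int a = k * int f" by (simp only: of_int_eq_iff)
      then have "f dvd a" by (metis dvd_triv_right int_dvd_int_iff)
      with that show False by (auto dest: dvd_imp_le)
    qed
    have "(\<lambda>m. \<Sum>a\<in>{1..<f}. \<psi> (int a) *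
        (\<Sum>k<m. 1 / (of_nat a / of_nat f + of_nat k) - 1 / (1 - of_nat a / of_nat f + of_nat k)))
      \<longlonglongrightarrow> (\<Sum>a\<in>{1..<f}. \<psi> (int a) * (of_real pi * cot (of_real pi * (of_nat a / of_nat f))))"
      by (intro tendsto_sum tendsto_mult tendsto_const pi_cot_partial_fractions nonint)
    from tendsto_mult[OF tendsto_const[of "of_real (1 / (2 * real f))"] this]
    have "(\<lambda>m. of_real (1 / (2 * real f)) * (\<Sum>a\<in>{1..<f}. \<psi> (int a) *
        (\<Sum>k<m. 1 / (of_nat a / of_nat f + of_nat k) - 1 / (1 - of_nat a / of_nat f + of_nat k))))
      \<longlonglongrightarrow> of_real (1 / (2 * real f)) *
          (\<Sum>a\<in>{1..<f}. \<psi> (int a) * (of_real pi * cot (of_real pi * (of_nat a / of_nat f))))" .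
    also have "of_real (1 / (2 * real f)) *
          (\<Sum>a\<in>{1..<f}. \<psi> (int a) * (of_real pi * cot (of_real pi * (of_nat a / of_nat f)))) = ?L"
      by (simp add: cot_of_real sum_distrib_left mult_ac)
    also have "(\<lambda>m. of_real (1 / (2 * real f)) * (\<Sum>a\<in>{1..<f}. \<psi> (int a) *
        (\<Sum>k<m. 1 / (of_nat a / of_nat f + of_nat k) - 1 / (1 - of_nat a / of_nat f + of_nat k))))
       = (\<lambda>m. \<Sum>n<m * f. t n)"
      unfolding sum.nat_group[symmetric] block
      by (subst sum_distrib_left[symmetric], subst sum.swap) (simp add: sum_distrib_left)
    finally show "(\<lambda>m. \<Sum>n<m * f. t n) \<longlonglongrightarrow> ?L" .
    show "norm (t n) \<le> 1 / real n" if "n > 0" for n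
      using that norm_dirichlet_character_le[OF \<psi>, of "int n"] f
      by (simp add: t_def norm_divide divide_right_mono)
  qed (use f in auto)
  \<comment> \<open>The term at 0 is 0, so starting the series at n = 1, as the L-function does,
    does not change the sum.\<close>
  then have "(\<lambda>n. t (Suc n)) sums ?L"
    by (subst sums_Suc_iff) (simp add: t_def)
  then show ?thesis
    unfolding dirichlet_L_def t_def by (simp add: sums_iff)
qed

section \<open>The mean square of L-values\<close>

definition cot_mod :: "nat \<Rightarrow> int \<Rightarrow> real" where
  "cot_mod f n = cot (pi * of_int n / of_nat f)"

lemma cot_plus_int_pi: "cot (x + of_int n * pi) = cot (x :: real)"
proof -
  have s: "sin (of_int n * pi) = 0" using sin_zero_iff_int2 by blast
  have c: "cos (of_int n * pi) \<noteq> 0"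
    using sin_cos_squared_add[of "of_int n * pi"] unfolding s by auto
  show ?thesis using c s by (simp add: cot_def sin_add cos_add)
qed

lemma cot_mod_cong:
  assumes "f > 0" "[m = n] (mod int f)"
  shows "cot_mod f m = cot_mod f n"
proof -
  obtain k where "n = m + int f * k" using assms(2) by (auto simp: cong_iff_lin)
  then have "pi * of_int n / of_nat f = pi * of_int m / of_nat f + of_int k * pi"
    using assms(1) by (simp add: field_simps)
  then show ?thesis by (simp only: cot_mod_def cot_plus_int_pi)
qed

lemma cot_mod_minus: "cot_mod f (- n) = - cot_mod f n"
  by (simp add: cot_mod_def)

section \<open>The unit group modulo f and sums over it\<close>

lemma mult_unit_group: "x \<otimes>\<^bsub>unit_group f\<^esub> y = (x * y) mod int f"
  by (simp add: units_of_mult residue_ring_def)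

lemma one_unit_group: "\<one>\<^bsub>unit_group f\<^esub> = 1"
  by (simp add: units_of_one residue_ring_def)

lemma comm_group_unit_group:
  assumes "f > 1"
  shows "comm_group (unit_group f)"
proof -
  interpret residues "int f" "residue_ring (int f)"
    using assms by unfold_locales auto
  show ?thesis using comm_monoid by (rule comm_monoid.units_comm_group)
qed

lemma finite_unit_group: "f > 1 \<Longrightarrow> finite (carrier (unit_group f))"
  by (rule finite_subset[of _ "{0..<int f}"]) (auto simp: carrier_unit_group)

lemma mod_in_unit_group:
  assumes "f > 1" "coprime n (int f)"
  shows "n mod int f \<in> carrier (unit_group f)"
  using assms by (simp add: carrier_unit_group)

lemma bij_betw_mult_unit_group:
  assumes f: "f > 1" and u: "coprime u (int f)"
  shows "bij_betw (\<lambda>n. u * n mod int f) (carrier (unit_group f)) (carrier (unit_group f))"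
proof -
  let ?h = "\<lambda>n. u * n mod int f"
  have "?h ` carrier (unit_group f) \<subseteq> carrier (unit_group f)"
    using f u by (auto simp: carrier_unit_group)
  moreover have "inj_on ?h (carrier (unit_group f))"
  proof (rule inj_onI)
    fix x y assume xy: "x \<in> carrier (unit_group f)" "y \<in> carrier (unit_group f)" "?h x = ?h y"
    then have "[u * x = u * y] (mod int f)" by (simp add: cong_def)
    then have "[x = y] (mod int f)" using u by (simp add: cong_mult_lcancel)
    then show "x = y" using xy f by (simp add: carrier_unit_group cong_def)
  qed
  ultimately show ?thesis
    using finite_unit_group[OF f] by (simp add: bij_betw_def endo_inj_surj)
qed

lemma sum_unit_group_mult:
  assumes "f > 1" "coprime u (int f)" "\<And>m n. [m = n] (mod int f) \<Longrightarrow> F m = F n"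
  shows "(\<Sum>n\<in>carrier (unit_group f). F (u * n)) = (\<Sum>n\<in>carrier (unit_group f). F n)"
proof -
  have "(\<Sum>n\<in>carrier (unit_group f). F (u * n)) = (\<Sum>n\<in>carrier (unit_group f). F (u * n mod int f))"
    by (intro sum.cong refl assms(3)) (simp add: cong_def)
  also have "\<dots> = (\<Sum>n\<in>carrier (unit_group f). F n)"
    by (rule sum.reindex_bij_betw[OF bij_betw_mult_unit_group[OF assms(1,2)]])
  finally show ?thesis .
qed

lemma unit_group_eq_image:
  assumes "f > 1"
  shows "carrier (unit_group f) = int ` {n. 1 \<le> n \<and> n \<le> f - 1 \<and> coprime n f}"
proof (intro equalityI subsetI)
  fix x assume x: "x \<in> carrier (unit_group f)"
  then have "x \<noteq> 0" using assms by (intro notI) (auto simp: carrier_unit_group)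
  then have "nat x \<in> {n. 1 \<le> n \<and> n \<le> f - 1 \<and> coprime n f}" "x = int (nat x)"
    using x assms by (auto simp: carrier_unit_group coprime_int_iff[symmetric] simp del: coprime_int_iff)
  then show "x \<in> int ` {n. 1 \<le> n \<and> n \<le> f - 1 \<and> coprime n f}" by blast
qed (use assms in \<open>auto simp: carrier_unit_group\<close>)

lemma sum_unit_group_eq:
  assumes "f > 1"
  shows "(\<Sum>n\<in>carrier (unit_group f). F n) = (\<Sum>n | 1 \<le> n \<and> n \<le> f - 1 \<and> coprime n f. F (int n))"
  unfolding unit_group_eq_image[OF assms] by (subst sum.reindex) (auto simp: inj_on_def)

lemma card_unit_group:
  assumes "f > 1"
  shows "card (carrier (unit_group f)) = totient f"
proof -
  have "{n. 1 \<le> n \<and> n \<le> f - 1 \<and> coprime n f} = totatives f"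
    using assms by (auto simp: totatives_def order_le_less)
  then show ?thesis
    unfolding unit_group_eq_image[OF assms] totient_def by (simp add: card_image)
qed

lemma dedekind_sum_mod_eq:
  assumes "f > 1"
  shows "dedekind_sum_mod c f = (\<Sum>n\<in>carrier (unit_group f). cot_mod f n * cot_mod f (n * c)) / (4 * real f)"
  unfolding dedekind_sum_mod_def sum_unit_group_eq[OF assms] by (simp add: cot_mod_def mult.assoc)

lemma dirichlet_L_1_odd_unit_group:
  assumes "dirichlet_character f \<psi>" "\<psi> (- 1) = - 1" "f > 1"
  shows "dirichlet_L 1 \<psi> =
           of_real (pi / (2 * real f)) * (\<Sum>n\<in>carrier (unit_group f). \<psi> n * of_real (cot_mod f n))"
proof -
  have "(\<Sum>a\<in>{1..<f}. \<psi> (int a) * of_real (cot (pi * real a / real f)))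
     = (\<Sum>n | 1 \<le> n \<and> n \<le> f - 1 \<and> coprime n f. \<psi> (int n) * of_real (cot_mod f (int n)))"
    using dirichlet_character_eq_0[OF assms(1), of "int _"] assms(3)
    by (intro sum.mono_neutral_cong_right) (auto simp: cot_mod_def)
  then show ?thesis
    by (simp only: dirichlet_L_1_odd[OF assms] sum_unit_group_eq[OF assms(3)])
qed

section \<open>Existence and orthogonality of odd Dirichlet characters\<close>

lemma dirichlet_character_of_group_character:
  assumes f: "f > 1" and \<phi>: "character_on (unit_group f) (carrier (unit_group f)) \<phi>"
  shows "dirichlet_character f (\<lambda>n. if coprime n (int f) then \<phi> (n mod int f) else 0)"
proof -
  interpret comm_group "unit_group f" by (rule comm_group_unit_group[OF f])
  have "\<phi> 1 = 1"
    using character_on_one[OF \<phi> subgroup_self] by (simp add: one_unit_group)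
  moreover have "\<phi> (m * n mod int f) = \<phi> (m mod int f) * \<phi> (n mod int f)"
    if "coprime m (int f)" "coprime n (int f)" for m n
  proof -
    have "\<phi> ((m mod int f) \<otimes>\<^bsub>unit_group f\<^esub> (n mod int f)) = \<phi> (m mod int f) * \<phi> (n mod int f)"
      using \<phi> that f unfolding character_on_def by (simp add: mod_in_unit_group)
    then show ?thesis by (simp add: mult_unit_group mod_mult_eq)
  qed
  moreover have "\<phi> (n mod int f) \<noteq> 0" if "coprime n (int f)" for n
    using \<phi> that f unfolding character_on_def by (simp add: mod_in_unit_group)
  moreover have "coprime (n + int f) (int f) \<longleftrightarrow> coprime n (int f)" for n
    by (simp add: coprime_iff_gcd_eq_1)
  ultimately show ?thesis
    using f unfolding dirichlet_character_def by auto
qed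

lemma separating_dirichlet_character:
  assumes f: "f > 1" and K: "subgroup K (unit_group f)" and u: "u \<in> carrier (unit_group f)" "u \<notin> K"
  shows "\<exists>\<psi>. dirichlet_character f \<psi> \<and> (\<forall>h\<in>K. \<psi> h = 1) \<and> \<psi> u \<noteq> 1"
proof -
  interpret comm_group "unit_group f" by (rule comm_group_unit_group[OF f])
  obtain \<phi> where \<phi>: "character_on (unit_group f) (carrier (unit_group f)) \<phi>" "\<forall>x\<in>K. \<phi> x = 1" "\<phi> u \<noteq> 1"
    using separating_character[OF finite_unit_group[OF f] K u] by blast
  define \<psi> where "\<psi> n = (if coprime n (int f) then \<phi> (n mod int f) else 0)" for n
  have "dirichlet_character f \<psi>"
    using dirichlet_character_of_group_character[OF f \<phi>(1)] unfolding \<psi>_def .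
  moreover have "\<psi> n = \<phi> n" if "n \<in> carrier (unit_group f)" for n
    using that f by (auto simp: carrier_unit_group \<psi>_def)
  then have "(\<forall>h\<in>K. \<psi> h = 1) \<and> \<psi> u \<noteq> 1"
    using \<phi>(2,3) u(1) subgroup.subset[OF K] by (metis subsetD)
  ultimately show ?thesis by blast
qed

text \<open>A character is determined by its values on one period, each of them 0 or a root of unity
  of order dividing \<open>totient f\<close>. Finiteness is needed to make injective self-maps of
  this set bijective and its cardinality meaningful.\<close>

lemma finite_odd_characters:
  assumes f: "f > 1"
  shows "finite (odd_characters f H)"
proof -
  define Z where "Z = insert 0 {z :: complex. z ^ totient f = 1}"
  have finZ: "finite Z" using f by (simp add: Z_def finite_roots_unity Suc_le_eq)
  have "inj_on (\<lambda>\<psi>. restrict \<psi> {0..<int f}) (odd_characters f H)"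
  proof (rule inj_onI)
    fix \<psi> \<phi> assume *: "\<psi> \<in> odd_characters f H" "\<phi> \<in> odd_characters f H"
      and eq: "restrict \<psi> {0..<int f} = restrict \<phi> {0..<int f}"
    show "\<psi> = \<phi>"
    proof
      fix n
      have "[n = n mod int f] (mod int f)" by (simp add: cong_def)
      then have "\<psi> n = \<psi> (n mod int f)" "\<phi> n = \<phi> (n mod int f)"
        using * dirichlet_character_cong unfolding odd_characters_def by blast+
      moreover have "n mod int f \<in> {0..<int f}" using f by simp
      ultimately show "\<psi> n = \<phi> n" using eq by (metis restrict_apply')
    qed
  qed
  moreover have "(\<lambda>\<psi>. restrict \<psi> {0..<int f}) ` odd_characters f H \<subseteq> (\<Pi>\<^sub>E n\<in>{0..<int f}. Z)"
  proof -
    have "\<psi> n \<in> Z" if "\<psi> \<in> odd_characters f H" for \<psi> n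
      using that f unfolding odd_characters_def Z_def
      by (cases "coprime n (int f)") (auto simp: dirichlet_character_root_of_unity dirichlet_character_eq_0)
    then show ?thesis by auto
  qed
  moreover have "finite (\<Pi>\<^sub>E n\<in>{0..<int f}. Z)" using finZ by (intro finite_PiE) auto
  ultimately show ?thesis by (meson inj_on_finite)
qed

lemma dirichlet_character_mult:
  assumes "dirichlet_character f \<psi>" "dirichlet_character f \<phi>"
  shows "dirichlet_character f (\<lambda>n. \<psi> n * \<phi> n)"
  using assms unfolding dirichlet_character_def by auto

lemma dirichlet_character_minus_one:
  assumes "dirichlet_character f \<psi>"
  shows "\<psi> (- 1) = 1 \<or> \<psi> (- 1) = - 1"
proof -
  have "\<psi> (- 1) * \<psi> (- 1) = \<psi> ((- 1) * (- 1))"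
    using assms unfolding dirichlet_character_def by metis
  also have "\<dots> = 1" using assms by (simp add: dirichlet_character_def)
  finally show ?thesis using square_eq_1_iff by blast
qed

lemma minus_one_mod_in_unit_group:
  "f > 1 \<Longrightarrow> (- 1) mod int f \<in> carrier (unit_group f)"
  by (intro mod_in_unit_group) auto

text \<open>A character trivial on \<open>H\<close> that separates -1 from \<open>H\<close> is odd,
  because its value at -1 squares to 1.\<close>

lemma odd_characters_nonempty:
  assumes f: "f > 1" and H: "subgroup H (unit_group f)" and "(- 1) mod int f \<notin> H"
  shows "odd_characters f H \<noteq> {}"
proof -
  obtain \<psi> where \<psi>: "dirichlet_character f \<psi>" "\<forall>h\<in>H. \<psi> h = 1" "\<psi> ((- 1) mod int f) \<noteq> 1"
    using separating_dirichlet_character[OF f H minus_one_mod_in_unit_group[OF f] assms(3)] by blast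
  have "\<psi> ((- 1) mod int f) = \<psi> (- 1)"
    by (rule dirichlet_character_cong[OF \<psi>(1)]) (simp add: cong_def)
  then have "\<psi> (- 1) = - 1" using \<psi>(3) dirichlet_character_minus_one[OF \<psi>(1)] by auto
  then show ?thesis using \<psi> by (auto simp: odd_characters_def)
qed

text \<open>This set is the union of H and -H. It must be a subgroup so that one character trivial
  on all of it can separate a further element.\<close>

lemma subgroup_pm:
  assumes f: "f > 1" and H: "subgroup H (unit_group f)"
  shows "subgroup {x \<in> carrier (unit_group f). x \<in> H \<or> (- x) mod int f \<in> H} (unit_group f)" (is "subgroup ?K _")
proof -
  interpret comm_group "unit_group f" by (rule comm_group_unit_group[OF f])
  show ?thesis
  proof (rule finite_subgroupI[OF finite_unit_group[OF f]])
    show "\<one>\<^bsub>unit_group f\<^esub> \<in> ?K" using H by (auto simp: subgroup.one_closed)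
    fix x y assume x: "x \<in> ?K" and y: "y \<in> ?K"
    have m: "a * b mod int f \<in> H" if "a \<in> H" "b \<in> H" for a b
      using subgroup.m_closed[OF H that] by (simp add: mult_unit_group)
    consider "x \<in> H" "y \<in> H" | "(-x) mod int f \<in> H" "y \<in> H" | "x \<in> H" "(-y) mod int f \<in> H"
      | "(-x) mod int f \<in> H" "(-y) mod int f \<in> H" using x y by blast
    then have "x * y mod int f \<in> H \<or> (- (x * y mod int f)) mod int f \<in> H"
    proof cases
      case 1
      then show ?thesis using m by blast
    next
      case 2
      from m[OF this] show ?thesis by (simp add: mod_mult_left_eq mod_minus_eq)
    next
      case 3
      from m[OF this] show ?thesis by (simp add: mod_mult_right_eq mod_minus_eq)
    next
      case 4
      from m[OF this] show ?thesis by (simp add: mod_mult_eq)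
    qed
    moreover have "x \<otimes>\<^bsub>unit_group f\<^esub> y \<in> carrier (unit_group f)" using x y by simp
    ultimately show "x \<otimes>\<^bsub>unit_group f\<^esub> y \<in> ?K" by (simp add: mult_unit_group)
  qed auto
qed

text \<open>On H every term is 1, on -H every term is -1. For any other \<open>u\<close> take \<eta>
  trivial on both H and -H with \<eta>(u) different from 1: multiplication by \<eta> permutes the
  odd characters trivial on H, so the sum equals \<eta>(u) times itself and is 0.\<close>

lemma sum_odd_characters:
  assumes f: "f > 1" and H: "subgroup H (unit_group f)" and H1: "(- 1) mod int f \<notin> H"
    and u: "u \<in> carrier (unit_group f)"
  shows "(\<Sum>\<psi>\<in>odd_characters f H. \<psi> u) =
    of_nat (card (odd_characters f H)) * (of_bool (u \<in> H) - of_bool ((- u) mod int f \<in> H))"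
proof -
  let ?X = "odd_characters f H"
  interpret comm_group "unit_group f" by (rule comm_group_unit_group[OF f])
  have X: "dirichlet_character f \<psi>" "\<psi> (- 1) = - 1" "\<forall>h\<in>H. \<psi> h = 1" if "\<psi> \<in> ?X" for \<psi>
    using that by (auto simp: odd_characters_def)
  \<comment> \<open>Otherwise an odd character trivial on H would be 1 at both u and -u. Hence at
    most one of the two indicators is nonzero.\<close>
  have disj: "\<not> (u \<in> H \<and> (- u) mod int f \<in> H)"
  proof
    assume *: "u \<in> H \<and> (- u) mod int f \<in> H"
    obtain \<psi> where \<psi>: "\<psi> \<in> ?X" using odd_characters_nonempty[OF f H H1] by blast
    have "\<psi> ((- u) mod int f) = \<psi> (- 1 * u)"
      by (rule dirichlet_character_cong[OF X(1)[OF \<psi>]]) (simp add: cong_def)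
    also have "\<dots> = - \<psi> u"
      using X(1,2)[OF \<psi>] unfolding dirichlet_character_def by (metis mult_minus1)
    finally show False using * X(3)[OF \<psi>] by auto
  qed
  consider "u \<in> H" | "(- u) mod int f \<in> H" | "u \<notin> H" "(- u) mod int f \<notin> H" by blast
  then show ?thesis
  proof cases
    case 1
    then have "(\<Sum>\<psi>\<in>?X. \<psi> u) = (\<Sum>\<psi>\<in>?X. 1)" using X(3) by (intro sum.cong) auto
    then show ?thesis using 1 disj by simp
  next
    case 2
    have "\<psi> u = - 1" if \<psi>: "\<psi> \<in> ?X" for \<psi>
    proof -
      have "\<psi> ((- u) mod int f) = \<psi> (- 1 * u)"
        by (rule dirichlet_character_cong[OF X(1)[OF \<psi>]]) (simp add: cong_def)
      also have "\<dots> = - \<psi> u"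
        using X(1,2)[OF \<psi>] unfolding dirichlet_character_def by (metis mult_minus1)
      finally show ?thesis using 2 X(3)[OF \<psi>] by (metis minus_minus)
    qed
    then have "(\<Sum>\<psi>\<in>?X. \<psi> u) = (\<Sum>\<psi>\<in>?X. - 1)" by (intro sum.cong) auto
    then show ?thesis using 2 disj by simp
  next
    case 3
    let ?K = "{x \<in> carrier (unit_group f). x \<in> H \<or> (- x) mod int f \<in> H}"
    have "u \<notin> ?K" using 3 by blast
    then obtain \<eta> where \<eta>: "dirichlet_character f \<eta>" "\<forall>h\<in>?K. \<eta> h = 1" "\<eta> u \<noteq> 1"
      using separating_dirichlet_character[OF f subgroup_pm[OF f H] u] by blast
    have \<eta>H: "\<eta> h = 1" if "h \<in> H" for h using \<eta>(2) that subgroup.subset[OF H] by blast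
    \<comment> \<open>The identity lies in H, so -1 lies in -H; this makes \<eta> even, and twisting
      by it preserves oddness.\<close>
    have "(- 1) mod int f \<in> ?K"
    proof -
      have "(- ((- 1) mod int f)) mod int f = 1" using f by (simp add: mod_minus_eq)
      then show ?thesis
        using minus_one_mod_in_unit_group[OF f] subgroup.one_closed[OF H] by (simp add: one_unit_group)
    qed
    then have "\<eta> ((- 1) mod int f) = 1" using \<eta>(2) by blast
    moreover have "\<eta> ((- 1) mod int f) = \<eta> (- 1)"
      by (rule dirichlet_character_cong[OF \<eta>(1)]) (simp add: cong_def)
    ultimately have \<eta>1: "\<eta> (- 1) = 1" by simp
    define T where "T \<psi> = (\<lambda>n. \<eta> n * \<psi> n)" for \<psi> :: "int \<Rightarrow> complex"
    have TX: "T ` ?X \<subseteq> ?X"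
      using \<eta>1 \<eta>H dirichlet_character_mult[OF \<eta>(1)] by (auto simp: odd_characters_def T_def)
    have "inj_on T ?X"
    proof (rule inj_onI)
      fix \<psi> \<phi> assume *: "\<psi> \<in> ?X" "\<phi> \<in> ?X" "T \<psi> = T \<phi>"
      show "\<psi> = \<phi>"
      proof
        fix n
        have "\<eta> n * \<psi> n = \<eta> n * \<phi> n" using *(3) unfolding T_def by meson
        \<comment> \<open>Where \<eta> vanishes it cannot be cancelled, but there n is not a unit
          and the other two characters vanish too.\<close>
        moreover have "\<psi> n = 0 \<and> \<phi> n = 0" if "\<eta> n = 0"
          using that \<eta>(1) X(1)[OF *(1)] X(1)[OF *(2)] unfolding dirichlet_character_def by blast
        ultimately show "\<psi> n = \<phi> n" by auto
      qed
    qed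
    then have "bij_betw T ?X ?X"
      using endo_inj_surj[OF finite_odd_characters[OF f] TX] by (simp add: bij_betw_def)
    then have "(\<Sum>\<psi>\<in>?X. T \<psi> u) = (\<Sum>\<psi>\<in>?X. \<psi> u)"
      by (rule sum.reindex_bij_betw)
    then have "\<eta> u * (\<Sum>\<psi>\<in>?X. \<psi> u) = (\<Sum>\<psi>\<in>?X. \<psi> u)"
      by (simp add: T_def sum_distrib_left)
    then have "(\<Sum>\<psi>\<in>?X. \<psi> u) = 0" using \<eta>(3) by simp
    then show ?thesis using 3 by simp
  qed
qed

text \<open>Expand the square as a double sum over units m, n and substitute n = mu. The character
  then depends on u alone, since \<psi>(m) has modulus 1, and the sum over m of c(m) c(mu) is 4f
  times the Dedekind sum of u. The constant is (pi/(2f))^2 times 4f.\<close>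

lemma norm_dirichlet_L_1_squared:
  assumes \<psi>: "dirichlet_character f \<psi>" "\<psi> (- 1) = - 1" and f: "f > 1"
  shows "of_real ((norm (dirichlet_L 1 \<psi>))\<^sup>2) = of_real (pi\<^sup>2 / real f) *
    (\<Sum>u\<in>carrier (unit_group f). of_real (dedekind_sum_mod u f) * \<psi> u)"
proof -
  let ?R = "carrier (unit_group f)"
  let ?c = "\<lambda>n. complex_of_real (cot_mod f n)"
  have per: "\<psi> m = \<psi> n" if "[m = n] (mod int f)" for m n
    using dirichlet_character_cong[OF \<psi>(1) that] .
  have mult: "\<psi> (m * n) = \<psi> m * \<psi> n" for m n using \<psi> by (simp add: dirichlet_character_def)
  have cop: "coprime n (int f)" if "n \<in> ?R" for n using that f by (simp add: carrier_unit_group)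
  have cper: "cot_mod f m = cot_mod f n" if "[m = n] (mod int f)" for m n
    using cot_mod_cong that f by simp
  have "(\<Sum>n\<in>?R. \<psi> n * ?c n) * cnj (\<Sum>m\<in>?R. \<psi> m * ?c m)
      = (\<Sum>m\<in>?R. cnj (\<psi> m) * ?c m * (\<Sum>n\<in>?R. \<psi> n * ?c n))"
  proof -
    have "s * cnj (\<Sum>m\<in>?R. \<psi> m * ?c m) = (\<Sum>m\<in>?R. cnj (\<psi> m) * ?c m * s)" for s
      by (simp add: sum_distrib_left mult_ac)
    then show ?thesis by blast
  qed
  also have "\<dots> = (\<Sum>m\<in>?R. cnj (\<psi> m) * ?c m * (\<Sum>u\<in>?R. \<psi> (m * u) * ?c (m * u)))"
  proof (rule sum.cong[OF refl])
    fix m assume "m \<in> ?R"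
    then have m: "coprime m (int f)" by (rule cop)
    have "\<psi> a * ?c a = \<psi> b * ?c b" if "[a = b] (mod int f)" for a b
      using per[OF that] cper[OF that] by simp
    from sum_unit_group_mult[where F = "\<lambda>n. \<psi> n * ?c n", OF f m this]
    show "cnj (\<psi> m) * ?c m * (\<Sum>n\<in>?R. \<psi> n * ?c n)
        = cnj (\<psi> m) * ?c m * (\<Sum>u\<in>?R. \<psi> (m * u) * ?c (m * u))" by simp
  qed
  also have "\<dots> = (\<Sum>m\<in>?R. \<Sum>u\<in>?R. \<psi> u * (?c m * ?c (m * u)))"
  proof (intro sum.cong refl)
    fix m assume "m \<in> ?R"
    then have "norm (\<psi> m) = 1"
      using cop f by (intro norm_dirichlet_character[OF \<psi>(1)]) auto
    then have 1: "cnj (\<psi> m) * \<psi> m = 1"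
      using complex_norm_square[of "\<psi> m"] by (simp add: mult.commute)
    show "cnj (\<psi> m) * ?c m * (\<Sum>u\<in>?R. \<psi> (m * u) * ?c (m * u)) = (\<Sum>u\<in>?R. \<psi> u * (?c m * ?c (m * u)))"
      unfolding sum_distrib_left mult
    proof (intro sum.cong refl)
      fix u
      have "cnj (\<psi> m) * ?c m * (\<psi> m * \<psi> u * ?c (m * u)) = (cnj (\<psi> m) * \<psi> m) * (\<psi> u * (?c m * ?c (m * u)))"
        by (simp only: mult_ac)
      then show "cnj (\<psi> m) * ?c m * (\<psi> m * \<psi> u * ?c (m * u)) = \<psi> u * (?c m * ?c (m * u))"
        unfolding 1 by simp
    qed
  qed
  also have "\<dots> = (\<Sum>u\<in>?R. \<Sum>m\<in>?R. \<psi> u * (?c m * ?c (m * u)))" by (rule sum.swap)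
  also have "\<dots> = (\<Sum>u\<in>?R. of_real (4 * real f) * (of_real (dedekind_sum_mod u f) * \<psi> u))"
    using f by (intro sum.cong refl) (simp add: dedekind_sum_mod_eq flip: sum_distrib_left)
  finally have "(\<Sum>n\<in>?R. \<psi> n * ?c n) * cnj (\<Sum>m\<in>?R. \<psi> m * ?c m)
    = of_real (4 * real f) * (\<Sum>u\<in>?R. of_real (dedekind_sum_mod u f) * \<psi> u)"
    by (simp only: sum_distrib_left)
  moreover have "complex_of_real ((norm (dirichlet_L 1 \<psi>))\<^sup>2) = of_real (pi / (2 * real f)) ^ 2 *
     ((\<Sum>n\<in>?R. \<psi> n * ?c n) * cnj (\<Sum>m\<in>?R. \<psi> m * ?c m))"
    unfolding complex_norm_square dirichlet_L_1_odd_unit_group[OF \<psi> f] complex_cnj_mult complex_cnj_complex_of_real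
    by (simp only: power2_eq_square mult_ac)
  ultimately show ?thesis
    using f by (simp add: power2_eq_square)
qed

text \<open>Averaging over characters selects the classes in H with sign + and those in -H with sign
  -. The Dedekind sum is odd in its first argument, so both parts contribute equally, whence the
  factor 2.\<close>

theorem mean_square_L_eq:
  assumes f: "f > 1" and H: "subgroup H (unit_group f)" and H1: "(- 1) mod int f \<notin> H"
  shows "mean_square_L f H = 2 * pi\<^sup>2 / real f * S_mod f H"
proof -
  let ?X = "odd_characters f H" and ?R = "carrier (unit_group f)"
  let ?D = "\<lambda>u. dedekind_sum_mod u f"
  have HR: "H \<subseteq> ?R" by (rule subgroup.subset[OF H])
  have D: "?D m = ?D n" if "[m = n] (mod int f)" for m n
    using f that unfolding dedekind_sum_mod_eq[OF f]
    by (intro arg_cong2[of _ _ _ _ "(/)"] sum.cong refl arg_cong2[of _ _ _ _ "(*)"] cot_mod_cong cong_mult cong_refl) auto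
  have Dneg: "?D (- n) = - ?D n" for n
    unfolding dedekind_sum_mod_eq[OF f] by (simp add: cot_mod_minus sum_negf)
  have pos: "(\<Sum>u\<in>?R. ?D u * of_bool (u \<in> H)) = S_mod f H"
  proof -
    have "(\<Sum>u\<in>?R. ?D u * of_bool (u \<in> H)) = (\<Sum>u\<in>H. ?D u)"
      using HR finite_unit_group[OF f] by (intro sum.mono_neutral_cong_right) auto
    then show ?thesis by (simp add: S_mod_def)
  qed
  \<comment> \<open>The substitution of -u for u carries the sum over -H to the sum over H.\<close>
  have "(\<Sum>u\<in>?R. ?D u * of_bool ((- u) mod int f \<in> H)) = (\<Sum>u\<in>?R. ?D (-1 * u) * of_bool ((- (-1 * u)) mod int f \<in> H))"
  proof (rule sum_unit_group_mult[OF f, symmetric])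
    fix m n assume mn: "[m = n] (mod int f)"
    then have "(- m) mod int f = (- n) mod int f" by (metis cong_def cong_minus_minus_iff)
    then show "?D m * of_bool ((- m) mod int f \<in> H) = ?D n * of_bool ((- n) mod int f \<in> H)"
      using D[OF mn] by simp
  qed auto
  also have "\<dots> = - (\<Sum>u\<in>?R. ?D u * of_bool (u \<in> H))"
    unfolding sum_negf[symmetric]
    using f by (intro sum.cong refl) (auto simp: Dneg carrier_unit_group)
  finally have neg: "(\<Sum>u\<in>?R. ?D u * of_bool ((- u) mod int f \<in> H)) = - S_mod f H" by (simp add: pos)
  have "complex_of_real (\<Sum>\<psi>\<in>?X. (norm (dirichlet_L 1 \<psi>))\<^sup>2)
      = (\<Sum>\<psi>\<in>?X. of_real (pi\<^sup>2 / real f) * (\<Sum>u\<in>?R. of_real (?D u) * \<psi> u))"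
    unfolding of_real_sum using f
    by (intro sum.cong refl norm_dirichlet_L_1_squared) (auto simp: odd_characters_def)
  also have "\<dots> = of_real (pi\<^sup>2 / real f) * (\<Sum>u\<in>?R. of_real (?D u) * (\<Sum>\<psi>\<in>?X. \<psi> u))"
    by (subst (2) sum_distrib_left, subst sum.swap) (simp add: sum_distrib_left)
  also have "(\<Sum>u\<in>?R. of_real (?D u) * (\<Sum>\<psi>\<in>?X. \<psi> u)) =
      (\<Sum>u\<in>?R. of_real (real (card ?X) * (?D u * of_bool (u \<in> H) - ?D u * of_bool ((- u) mod int f \<in> H))))"
    by (intro sum.cong refl) (simp add: sum_odd_characters[OF f H H1] algebra_simps)
  also have "\<dots> = of_real (real (card ?X) * (2 * S_mod f H))"
    unfolding of_real_sum[symmetric] sum_distrib_left[symmetric] sum_subtractf pos neg by simp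
  finally have "complex_of_real (\<Sum>\<psi>\<in>?X. (norm (dirichlet_L 1 \<psi>))\<^sup>2) =
      of_real (pi\<^sup>2 / real f * (real (card ?X) * (2 * S_mod f H)))" by simp
  then have "(\<Sum>\<psi>\<in>?X. (norm (dirichlet_L 1 \<psi>))\<^sup>2) = pi\<^sup>2 / real f * (real (card ?X) * (2 * S_mod f H))"
    by (simp only: of_real_eq_iff)
  moreover have "card ?X \<noteq> 0"
    using finite_odd_characters[OF f] odd_characters_nonempty[OF f H H1] by simp
  ultimately show ?thesis by (simp add: mean_square_L_def field_simps)
qed

section \<open>The sum of squared cotangents\<close>

text \<open>At a root of unity w different from 1 with w^N = 1, the last sum vanishes and N/(w-1)
  remains: this is the Fourier coefficient of k on {0..<N}.\<close>

lemma sum_weighted_geometric: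
  fixes w :: "'a :: comm_ring_1"
  shows "(w - 1) * (\<Sum>k<N. of_nat k * w ^ k) = of_nat N * w ^ N - w * (\<Sum>k<N. w ^ k)"
  by (induction N) (simp_all add: algebra_simps)

lemma sum_roots_of_unity_powers:
  fixes w :: complex
  assumes "w ^ N = 1" "w \<noteq> 1"
  shows "(\<Sum>k<N. w ^ k) = 0"
  using assms geometric_sum[of w N] by simp

lemma norm_cis_minus_one: "(norm (cis (2 * t) - 1))\<^sup>2 = 4 * (sin t)\<^sup>2"
proof -
  have "(norm (cis (2 * t) - 1))\<^sup>2 = (cos (2 * t) - 1)\<^sup>2 + (sin (2 * t))\<^sup>2"
    by (simp add: cmod_power2)
  also have "\<dots> = 2 - 2 * cos (2 * t)"
    using sin_cos_squared_add[of "2 * t"] by (simp add: power2_eq_square algebra_simps)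
  also have "\<dots> = 4 * (sin t)\<^sup>2"
    by (simp add: cos_double_sin)
  finally show ?thesis .
qed

lemma sin_pi_frac_pos: "0 < n \<Longrightarrow> n < N \<Longrightarrow> sin (pi * real n / real N) > 0"
  by (intro sin_gt_zero) (auto simp: field_simps)

lemma cis_frac_eq_1_iff:
  assumes "N > 0"
  shows "cis (2 * pi * of_int j / real N) = 1 \<longleftrightarrow> int N dvd j"
proof
  assume "cis (2 * pi * of_int j / real N) = 1"
  then have "cos (2 * pi * of_int j / real N) = 1" by (simp add: complex_eq_iff)
  then obtain n :: int where "2 * pi * of_int j / real N = of_int n * 2 * pi"
    unfolding cos_one_2pi_int by blast
  then have "real_of_int j = of_int (n * int N)" using assms by (simp add: field_simps)
  then have "j = n * int N" by (simp only: of_int_eq_iff)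
  then show "int N dvd j" by simp
next
  assume "int N dvd j"
  then obtain k where "j = int N * k" by blast
  then have "2 * pi * of_int j / real N = 2 * pi * of_int k" using assms by simp
  then show "cis (2 * pi * of_int j / real N) = 1" by (simp add: cis_multiple_2pi)
qed

lemma cis_frac_power:
  assumes "N > 0" "x \<in> \<int>"
  shows "cis (2 * pi * x / real N) ^ N = 1"
proof -
  have "real N * (2 * pi * x / real N) = 2 * pi * x" using assms(1) by simp
  then show ?thesis unfolding Complex.DeMoivre using assms(2) by (simp only: cis_multiple_2pi)
qed

lemma parseval_discrete:
  fixes a :: "nat \<Rightarrow> real"
  assumes "N > 0"
  shows "(\<Sum>n<N. (norm (\<Sum>k<N. of_real (a k) * cis (2 * pi * real n / real N) ^ k))\<^sup>2)
           = real N * (\<Sum>k<N. (a k)\<^sup>2)"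
proof -
  let ?w = "\<lambda>n. cis (2 * pi * real n / real N)"
  have orth: "(\<Sum>n<N. ?w n ^ j * cnj (?w n ^ k)) = (if j = k then of_nat N else 0)"
    if "j < N" "k < N" for j k
  proof -
    define v where "v = cis (2 * pi * of_int (int j - int k) / real N)"
    have "?w n ^ j * cnj (?w n ^ k) = v ^ n" for n
      unfolding v_def Complex.DeMoivre cis_cnj cis_mult
      by (rule arg_cong[of _ _ cis]) (simp add: algebra_simps diff_divide_distrib)
    then have "(\<Sum>n<N. ?w n ^ j * cnj (?w n ^ k)) = (\<Sum>n<N. v ^ n)" by simp
    also have "\<dots> = (if j = k then of_nat N else 0)"
    proof (cases "j = k")
      case True
      then show ?thesis by (simp add: v_def)
    next
      case False
      have "\<not> int N dvd int j - int k"
      proof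
        assume "int N dvd int j - int k"
        then have "int j mod int N = int k mod int N" by (simp add: mod_eq_dvd_iff)
        with that False show False by simp
      qed
      then have "v \<noteq> 1" using cis_frac_eq_1_iff[OF assms] unfolding v_def by blast
      moreover have "v ^ N = 1"
        unfolding v_def using assms by (intro cis_frac_power) auto
      ultimately show ?thesis using False by (simp add: sum_roots_of_unity_powers)
    qed
    finally show ?thesis .
  qed
  have "complex_of_real (\<Sum>n<N. (norm (\<Sum>k<N. of_real (a k) * ?w n ^ k))\<^sup>2)
      = (\<Sum>n<N. (\<Sum>j<N. of_real (a j) * ?w n ^ j) * cnj (\<Sum>k<N. of_real (a k) * ?w n ^ k))"
    by (simp only: of_real_sum complex_norm_square)
  also have "\<dots> = (\<Sum>n<N. \<Sum>j<N. \<Sum>k<N. of_real (a j * a k) * (?w n ^ j * cnj (?w n ^ k)))"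
    by (simp add: cnj_sum sum_product mult_ac)
  also have "\<dots> = (\<Sum>j<N. \<Sum>n<N. \<Sum>k<N. of_real (a j * a k) * (?w n ^ j * cnj (?w n ^ k)))"
    by (rule sum.swap)
  also have "\<dots> = (\<Sum>j<N. \<Sum>k<N. \<Sum>n<N. of_real (a j * a k) * (?w n ^ j * cnj (?w n ^ k)))"
    by (intro sum.cong refl sum.swap)
  also have "\<dots> = (\<Sum>j<N. \<Sum>k<N. of_real (a j * a k) * (if j = k then of_nat N else 0))"
    unfolding sum_distrib_left[symmetric] by (intro sum.cong refl) (simp only: orth lessThan_iff)
  also have "\<dots> = (\<Sum>j<N. \<Sum>k<N. if j = k then of_real (a j * a k) * of_nat N else 0)"
    by (intro sum.cong refl) simp
  also have "\<dots> = (\<Sum>j<N. of_real (a j * a j) * of_nat N)"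
    by (intro sum.cong refl) simp
  also have "\<dots> = complex_of_real (real N * (\<Sum>k<N. (a k)\<^sup>2))"
    by (simp add: sum_distrib_left power2_eq_square mult_ac)
  finally show ?thesis by (simp only: of_real_eq_iff)
qed

text \<open>The Fourier coefficient N/(w-1) has squared modulus N^2 / (4 sin^2). Parseval then gives
  the sum once the coefficient at n = 0, the plain sum of the k, is subtracted; both sides are
  explicit power sums.\<close>

lemma sum_csc_squared:
  assumes "N > 0"
  shows "(\<Sum>n\<in>{1..<N}. 1 / (sin (pi * real n / real N))\<^sup>2) = (real N ^ 2 - 1) / 3"
proof -
  let ?w = "\<lambda>n. cis (2 * pi * real n / real N)"
  define A where "A n = (\<Sum>k<N. of_real (real k) * ?w n ^ k)" for n
  have A: "(norm (A n))\<^sup>2 = real N ^ 2 / 4 * (1 / (sin (pi * real n / real N))\<^sup>2)" if "n \<in> {1..<N}" for n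
  proof -
    have "?w n ^ N = 1"
      using assms by (intro cis_frac_power) auto
    moreover have "?w n \<noteq> 1"
      using cis_frac_eq_1_iff[OF assms, of "int n"] that by (auto dest: zdvd_imp_le)
    ultimately have "(?w n - 1) * A n = of_nat N"
      using sum_weighted_geometric[of "?w n" N] sum_roots_of_unity_powers[of "?w n" N]
      by (simp add: A_def)
    then have "(norm (?w n - 1))\<^sup>2 * (norm (A n))\<^sup>2 = real N ^ 2"
      by (metis norm_mult norm_of_nat power_mult_distrib)
    moreover have "?w n = cis (2 * (pi * real n / real N))"
      by (simp only: mult.assoc times_divide_eq_right)
    ultimately have "4 * (sin (pi * real n / real N))\<^sup>2 * (norm (A n))\<^sup>2 = real N ^ 2"
      by (simp only: norm_cis_minus_one)
    moreover have "sin (pi * real n / real N) > 0" using that by (intro sin_pi_frac_pos) auto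
    ultimately show ?thesis by (simp add: field_simps)
  qed
  have A0: "(norm (A 0))\<^sup>2 = (real N * (real N - 1) / 2)\<^sup>2"
  proof -
    have "2 * (\<Sum>k<N. real k) = real N * (real N - 1)"
      by (induction N) (simp_all add: algebra_simps)
    then have "(\<Sum>k<N. real k) = real N * (real N - 1) / 2" by simp
    moreover have "A 0 = of_real (\<Sum>k<N. real k)" by (simp add: A_def)
    ultimately show ?thesis by (simp only: norm_of_real power2_abs)
  qed
  have sq: "6 * (\<Sum>k<N. (real k)\<^sup>2) = real N * (real N - 1) * (2 * real N - 1)"
    by (induction N) (simp_all add: algebra_simps power2_eq_square)
  have "{..<N} = insert 0 {1..<N}" using assms by auto
  then have "(\<Sum>n<N. (norm (A n))\<^sup>2) = (norm (A 0))\<^sup>2 + (\<Sum>n\<in>{1..<N}. (norm (A n))\<^sup>2)"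
    by simp
  also have "(\<Sum>n\<in>{1..<N}. (norm (A n))\<^sup>2)
      = real N ^ 2 / 4 * (\<Sum>n\<in>{1..<N}. 1 / (sin (pi * real n / real N))\<^sup>2)"
    unfolding sum_distrib_left by (intro sum.cong refl A)
  finally have "real N ^ 2 / 4 * (\<Sum>n\<in>{1..<N}. 1 / (sin (pi * real n / real N))\<^sup>2)
      = real N * (\<Sum>k<N. (real k)\<^sup>2) - (real N * (real N - 1) / 2)\<^sup>2"
    using parseval_discrete[OF assms, of real] A0 by (simp add: A_def)
  also have "\<dots> = real N * (real N * (real N - 1) * (2 * real N - 1) / 6) - (real N * (real N - 1) / 2)\<^sup>2"
    using sq by simp
  also have "\<dots> = real N ^ 2 / 4 * ((real N ^ 2 - 1) / 3)"
    by (simp add: field_simps power2_eq_square)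
  finally show ?thesis using assms by simp
qed

text \<open>Adding a prime q to the sieve removes the terms n = qm, and qm/N = m/(N/q), so what is
  removed is the same sieved sum at level N/q. Hence \<open>N\<close> varies in the induction. The
  -1 in the unsieved value (N^2-1)/3 cancels at the first removal, which explains the case
  distinction.\<close>

lemma sum_csc_squared_sieve:
  assumes "finite P" "N > 0" "\<And>p. p \<in> P \<Longrightarrow> prime p \<and> p dvd N"
  shows "(\<Sum>n | n \<in> {1..<N} \<and> (\<forall>p\<in>P. \<not> p dvd n). 1 / (sin (pi * real n / real N))\<^sup>2)
     = (real N ^ 2 * (\<Prod>p\<in>P. 1 - 1 / real p ^ 2) - (if P = {} then 1 else 0)) / 3"
  using assms
proof (induction P arbitrary: N rule: finite_induct)
  case empty
  moreover have "{n \<in> {1..<N}. \<forall>p\<in>{}. \<not> p dvd n} = {1..<N}" by auto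
  ultimately show ?case using sum_csc_squared[of N] by (simp only: prod.empty simp_thms if_True mult_1_right)
next
  case (insert q P N)
  let ?F = "\<lambda>N n. 1 / (sin (pi * real n / real N))\<^sup>2"
  let ?A = "\<lambda>N. {n \<in> {1..<N}. \<forall>p\<in>P. \<not> p dvd n}"
  have q: "prime q" "q dvd N" using insert.prems by auto
  have q0: "q > 0" using q prime_gt_0_nat by blast
  define M where "M = N div q"
  have N: "N = q * M" using q by (simp add: M_def)
  have M0: "M > 0" using insert.prems(1) N by (cases M) auto
  have P: "prime p \<and> p dvd M" if "p \<in> P" for p
  proof -
    have p: "prime p" "p dvd q * M" using insert.prems(2)[of p] that N by auto
    have "\<not> p dvd q" using p(1) q(1) that insert.hyps primes_dvd_imp_eq by blast
    then show ?thesis using p by (simp add: prime_dvd_mult_iff)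
  qed
  have "{n. n \<in> {1..<N} \<and> (\<forall>p\<in>insert q P. \<not> p dvd n)} = ?A N - (\<lambda>n. q * n) ` ?A M"
  proof (intro equalityI subsetI)
    fix n assume n: "n \<in> ?A N - (\<lambda>n. q * n) ` ?A M"
    have "\<not> q dvd n"
    proof
      assume "q dvd n"
      then obtain m where m: "n = q * m" by blast
      with n N q0 have "m \<in> ?A M" by auto
      with n m show False by blast
    qed
    with n show "n \<in> {n. n \<in> {1..<N} \<and> (\<forall>p\<in>insert q P. \<not> p dvd n)}" by auto
  qed auto
  then have "(\<Sum>n | n \<in> {1..<N} \<and> (\<forall>p\<in>insert q P. \<not> p dvd n). ?F N n)
      = (\<Sum>n\<in>?A N - (\<lambda>n. q * n) ` ?A M. ?F N n)" by simp
  also have "\<dots> = (\<Sum>n\<in>?A N. ?F N n) - (\<Sum>n\<in>(\<lambda>n. q * n) ` ?A M. ?F N n)"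
  proof (rule sum_diff)
    have "\<not> p dvd q" if "p \<in> P" for p
      using insert.prems(2)[of p] q(1) that insert.hyps primes_dvd_imp_eq[of p q] by auto
    then show "(\<lambda>n. q * n) ` ?A M \<subseteq> ?A N"
      using N q0 insert.prems(2) by (auto simp: prime_dvd_mult_iff)
  qed auto
  also have "(\<Sum>n\<in>(\<lambda>n. q * n) ` ?A M. ?F N n) = (\<Sum>n\<in>?A M. ?F N (q * n))"
    using q0 by (subst sum.reindex) (auto simp: inj_on_def)
  also have "\<dots> = (\<Sum>n\<in>?A M. ?F M n)"
    using q0 N by (intro sum.cong refl) simp
  also have "(\<Sum>n\<in>?A N. ?F N n)
      = (real N ^ 2 * (\<Prod>p\<in>P. 1 - 1 / real p ^ 2) - (if P = {} then 1 else 0)) / 3"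
    using insert.prems by (intro insert.IH) auto
  also have "(\<Sum>n\<in>?A M. ?F M n)
      = (real M ^ 2 * (\<Prod>p\<in>P. 1 - 1 / real p ^ 2) - (if P = {} then 1 else 0)) / 3"
    using M0 P by (intro insert.IH) auto
  \<comment> \<open>N^2 - (N/q)^2 = N^2 (1 - 1/q^2), which supplies the new Euler factor, while the
    correction \<open>e\<close>, the same at both levels, drops out.\<close>
  also have "(real N ^ 2 * X - e) / 3 - (real M ^ 2 * X - e) / 3
      = real N ^ 2 * ((1 - 1 / real q ^ 2) * X) / 3" for X e :: real
    using q0 unfolding N by (simp add: field_simps power2_eq_square)
  finally show ?case using insert.hyps by simp
qed

text \<open>cot^2 = 1/sin^2 - 1: the sieve over the prime divisors of \<open>f\<close> evaluates the
  first part, and the second counts the units. As f > 1 has a prime divisor, the exceptional term of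
  the sieve is absent.\<close>

lemma sum_cot_squared_coprime:
  assumes "f > 1"
  shows "(\<Sum>n | 1 \<le> n \<and> n \<le> f - 1 \<and> coprime n f. (cot (pi * real n / real f))\<^sup>2)
     = real f ^ 2 * (\<Prod>p\<in>prime_factors f. 1 - 1 / real p ^ 2) / 3 - real (totient f)"
proof -
  have cop: "coprime n f \<longleftrightarrow> (\<forall>p\<in>prime_factors f. \<not> p dvd n)" for n
  proof
    assume cop: "coprime n f"
    show "\<forall>p\<in>prime_factors f. \<not> p dvd n"
    proof (intro ballI notI)
      fix p assume "p \<in> prime_factors f" "p dvd n"
      then show False using coprime_common_divisor[OF cop, of p] by (auto simp: in_prime_factors_iff)
    qed
  next
    assume *: "\<forall>p\<in>prime_factors f. \<not> p dvd n"
    show "coprime n f"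
    proof (rule ccontr)
      assume "\<not> coprime n f"
      then obtain p where "prime p" "p dvd gcd n f"
        using prime_factor_nat coprime_iff_gcd_eq_1 by blast
      with * assms show False by (auto simp: in_prime_factors_iff)
    qed
  qed
  have S: "{n. 1 \<le> n \<and> n \<le> f - 1 \<and> coprime n f} = {n. n \<in> {1..<f} \<and> (\<forall>p\<in>prime_factors f. \<not> p dvd n)}"
    using assms by (auto simp: cop)
  have tot: "{n. 1 \<le> n \<and> n \<le> f - 1 \<and> coprime n f} = totatives f"
    using assms by (auto simp: totatives_def order_le_less)
  have "(\<Sum>n | 1 \<le> n \<and> n \<le> f - 1 \<and> coprime n f. (cot (pi * real n / real f))\<^sup>2)
      = (\<Sum>n | 1 \<le> n \<and> n \<le> f - 1 \<and> coprime n f. 1 / (sin (pi * real n / real f))\<^sup>2 - 1)"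
  proof (intro sum.cong refl)
    fix n assume "n \<in> {n. 1 \<le> n \<and> n \<le> f - 1 \<and> coprime n f}"
    then have "sin (pi * real n / real f) > 0" using assms by (intro sin_pi_frac_pos) auto
    then show "(cot (pi * real n / real f))\<^sup>2 = 1 / (sin (pi * real n / real f))\<^sup>2 - 1"
      by (simp add: cot_def power_divide cos_squared_eq diff_divide_distrib)
  qed
  also have "\<dots> = (\<Sum>n | n \<in> {1..<f} \<and> (\<forall>p\<in>prime_factors f. \<not> p dvd n). 1 / (sin (pi * real n / real f))\<^sup>2)
      - real (card {n. 1 \<le> n \<and> n \<le> f - 1 \<and> coprime n f})"
    unfolding sum_subtractf S by simp
  also have "card {n. 1 \<le> n \<and> n \<le> f - 1 \<and> coprime n f} = totient f"
    unfolding tot totient_def ..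
  also have "(\<Sum>n | n \<in> {1..<f} \<and> (\<forall>p\<in>prime_factors f. \<not> p dvd n). 1 / (sin (pi * real n / real f))\<^sup>2)
     = (real f ^ 2 * (\<Prod>p\<in>prime_factors f. 1 - 1 / real p ^ 2) - (if prime_factors f = {} then 1 else 0)) / 3"
    using assms by (intro sum_csc_squared_sieve) auto
  finally show ?thesis
    using assms by (simp add: set_mset_eq_empty_iff prime_factorization_empty_iff)
qed

lemma totient_mult_prod_one_plus:
  "real (totient f) * (\<Prod>p\<in>prime_factors f. 1 + 1 / real p)
     = real f * (\<Prod>p\<in>prime_factors f. 1 - 1 / real p ^ 2)"
proof -
  have "(\<Prod>p\<in>prime_factors f. 1 - 1 / real p) * (\<Prod>p\<in>prime_factors f. 1 + 1 / real p)
     = (\<Prod>p\<in>prime_factors f. 1 - 1 / real p ^ 2)"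
    unfolding prod.distrib[symmetric]
    by (intro prod.cong refl) (simp add: algebra_simps power2_eq_square)
  then show ?thesis by (simp add: totient_formula2 mult.assoc)
qed

section \<open>Dedekind sums at classes of order 3\<close>

text \<open>Expand the sine of the sum by the addition formulas and divide by the product of the
  three sines.\<close>

lemma cot_three_term:
  fixes a b c :: real
  assumes "sin a \<noteq> 0" "sin b \<noteq> 0" "sin c \<noteq> 0" "sin (a + b + c) = 0"
  shows "cot a * cot b + cot b * cot c + cot c * cot a = 1"
proof -
  have "cos a * cos b * sin c + cos b * cos c * sin a + cos c * cos a * sin b = sin a * sin b * sin c"
    using assms(4) by (simp add: sin_add cos_add algebra_simps)
  then show ?thesis
    using assms(1-3) by (simp add: cot_def field_simps)
qed

lemma sin_pi_frac_eq_0_iff: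
  assumes "f > 0"
  shows "sin (pi * of_int n / of_nat f) = 0 \<longleftrightarrow> int f dvd n"
proof
  assume "sin (pi * of_int n / of_nat f) = 0"
  then obtain k :: int where "pi * of_int n / of_nat f = of_int k * pi"
    unfolding sin_zero_iff_int2 by blast
  then have "real_of_int n = of_int (k * int f)" using assms by (simp add: field_simps)
  then have "n = k * int f" by (simp only: of_int_eq_iff)
  then show "int f dvd n" by simp
next
  assume "int f dvd n"
  then obtain k where "n = int f * k" by blast
  then have "pi * of_int n / of_nat f = of_int k * pi" using assms by simp
  then show "sin (pi * of_int n / of_nat f) = 0" unfolding sin_zero_iff_int2 by blast
qed

lemma cot_mod_three_term:
  assumes "f > 0" "\<not> int f dvd a" "\<not> int f dvd b" "\<not> int f dvd c" "int f dvd a + b + c"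
  shows "cot_mod f a * cot_mod f b + cot_mod f b * cot_mod f c + cot_mod f c * cot_mod f a = 1"
  unfolding cot_mod_def
proof (rule cot_three_term)
  have "pi * of_int a / of_nat f + pi * of_int b / of_nat f + pi * of_int c / of_nat f
      = pi * of_int (a + b + c) / of_nat f"
    by (simp add: add_divide_distrib algebra_simps)
  then show "sin (pi * of_int a / of_nat f + pi * of_int b / of_nat f + pi * of_int c / of_nat f) = 0"
    using assms by (simp only: sin_pi_frac_eq_0_iff)
qed (use assms sin_pi_frac_eq_0_iff in auto)

lemma cubic_root_cube:
  fixes x n :: int
  assumes "n dvd x^2 + x + 1"
  shows "[x * x * x = 1] (mod n)"
proof -
  have "x * x * x - 1 = (x^2 + x + 1) * (x - 1)" by (simp add: power2_eq_square algebra_simps)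
  then show ?thesis using assms by (simp add: cong_iff_dvd_diff)
qed

lemma dedekind_sum_mod_cubic_root:
  assumes f: "f > 1" and x: "x \<in> cubic_roots f"
  shows "dedekind_sum_mod x f = real (totient f) / (12 * real f)"
proof -
  let ?R = "carrier (unit_group f)" and ?c = "cot_mod f"
  have xd: "int f dvd x^2 + x + 1" using x by (simp add: cubic_roots_def)
  have xc: "coprime x (int f)" by (rule coprime_cubic_root[OF xd])
  define G where "G n = ?c n * ?c (n * x)" for n
  have G: "G m = G n" if "[m = n] (mod int f)" for m n
    unfolding G_def using f that
    by (intro arg_cong2[of _ _ _ _ "(*)"] cot_mod_cong cong_mult cong_refl) auto
  have "real (totient f) = (\<Sum>n\<in>?R. 1)" using card_unit_group[OF f] by simp
  also have "\<dots> = (\<Sum>n\<in>?R. G n + G (x * n) + G (x * x * n))"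
  proof (intro sum.cong refl)
    fix n assume "n \<in> ?R"
    then have n: "coprime n (int f)" using f by (simp add: carrier_unit_group)
    have nd: "\<not> int f dvd m" if "coprime m (int f)" for m
      using that f coprime_common_divisor[of m "int f" "int f"] by auto
    have sum: "n + n * x + n * x * x = n * (x^2 + x + 1)"
      by (simp add: power2_eq_square algebra_simps)
    have "[n * (x * x * x) = n * 1] (mod int f)"
      by (intro cong_mult cong_refl cubic_root_cube xd)
    \<comment> \<open>Since x^3 = 1, multiplying the third angle by x returns to the first. The
      three products are thus G at n, xn and x^2 n, each with the same total over the units.\<close>
    then have c3: "?c (x * x * n * x) = ?c n"
      using f by (intro cot_mod_cong) (auto simp: mult_ac)
    have "?c n * ?c (n * x) + ?c (n * x) * ?c (n * x * x) + ?c (n * x * x) * ?c n = 1"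
      using f n xc xd nd by (intro cot_mod_three_term) (auto simp: sum)
    then show "1 = G n + G (x * n) + G (x * x * n)"
      unfolding G_def c3 by (simp add: mult_ac)
  qed
  also have "\<dots> = 3 * (\<Sum>n\<in>?R. G n)"
    using sum_unit_group_mult[where F = G, OF f xc G] sum_unit_group_mult[where F = G and u = "x * x", OF f _ G] xc
    by (simp add: sum.distrib)
  finally show ?thesis
    unfolding dedekind_sum_mod_eq[OF f] G_def by simp
qed

lemma dedekind_sum_mod_one:
  assumes f: "f > 1"
  shows "dedekind_sum_mod 1 f =
    (real f ^ 2 * (\<Prod>p\<in>prime_factors f. 1 - 1 / real p ^ 2) / 3 - real (totient f)) / (4 * real f)"
proof -
  have "(\<Sum>n\<in>carrier (unit_group f). cot_mod f n * cot_mod f (n * 1))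
      = (\<Sum>n | 1 \<le> n \<and> n \<le> f - 1 \<and> coprime n f. (cot (pi * real n / real f))\<^sup>2)"
    unfolding sum_unit_group_eq[OF f] by (simp add: cot_mod_def power2_eq_square)
  then show ?thesis
    by (simp only: dedekind_sum_mod_eq[OF f] sum_cot_squared_coprime[OF f])
qed

text \<open>The trivial class contributes -\<phi>(f)/(4f) besides its main term, and the two roots
  contribute \<phi>(f)/(12f) each; together this is -\<phi>(f)/(12f), the source of the -1/f in the
  bracket.\<close>

lemma S_mod_cubic_roots:
  assumes f: "f > 1" and xy: "x \<in> cubic_roots f" "y \<in> cubic_roots f" and d: "card {1, x, y} = 3"
  shows "S_mod f {1, x, y} = real (totient f) / 12 *
    ((\<Prod>p\<in>prime_factors f. 1 + 1 / real p) - 1 / real f)"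
proof -
  let ?P = "\<Prod>p\<in>prime_factors f. 1 - 1 / real p ^ 2"
  have "1 \<noteq> x" "1 \<noteq> y" "x \<noteq> y" using d by (auto simp: card_insert_if split: if_splits)
  then have "S_mod f {1, x, y} = (real f ^ 2 * ?P / 3 - real (totient f)) / (4 * real f)
      + 2 * (real (totient f) / (12 * real f))"
    using xy f by (simp add: S_mod_def dedekind_sum_mod_one dedekind_sum_mod_cubic_root)
  also have "\<dots> = (real f * ?P - real (totient f) / real f) / 12"
    using f by (simp add: field_simps power2_eq_square)
  also have "real f * ?P = real (totient f) * (\<Prod>p\<in>prime_factors f. 1 + 1 / real p)"
    by (rule totient_mult_prod_one_plus[symmetric])
  finally show ?thesis by (simp add: algebra_simps)
qed

section \<open>The subgroup of order 3 generated by a root\<close>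

lemma one_notin_cubic_roots:
  assumes "f > 1" "\<not> 3 dvd f"
  shows "1 \<notin> cubic_roots f"
proof
  assume "1 \<in> cubic_roots f"
  then have "int f dvd int 3" by (simp add: cubic_roots_def)
  then have "f dvd 3" by (simp only: int_dvd_int_iff)
  moreover have "prime (3::nat)" by simp
  ultimately show False using assms by (auto simp: prime_nat_iff)
qed

lemma cubic_root_in_unit_group:
  assumes "f > 1" "x \<in> cubic_roots f"
  shows "x \<in> carrier (unit_group f)"
  using assms coprime_cubic_root by (auto simp: carrier_unit_group cubic_roots_def)

lemma ord_cubic_root:
  assumes f: "f > 1" "\<not> 3 dvd f" and x: "x \<in> cubic_roots f"
  shows "group.ord (unit_group f) x = 3"
proof -
  interpret comm_group "unit_group f" by (rule comm_group_unit_group[OF f(1)])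
  have xc: "x \<in> carrier (unit_group f)" by (rule cubic_root_in_unit_group[OF f(1) x])
  have "x [^]\<^bsub>unit_group f\<^esub> (3::nat) = x * x * x mod int f"
    using xc by (simp add: numeral_3_eq_3 mult_unit_group one_unit_group mod_simps mult_ac)
  also have "\<dots> = 1"
    using cubic_root_cube[of "int f" x] x f by (simp add: cubic_roots_def cong_def)
  finally have "ord x dvd 3" using xc by (simp add: pow_eq_id[symmetric] one_unit_group)
  moreover have "x \<noteq> 1" using one_notin_cubic_roots[OF f] x by blast
  then have "ord x \<noteq> 1" using ord_eq_1[OF xc] by (simp only: one_unit_group not_False_eq_True)
  moreover have "prime (3::nat)" by simp
  ultimately show ?thesis by (auto simp: prime_nat_iff)
qed

text \<open>From x^3 = 1 and xy = 1 follow x^2 = y and y^2 = x, which is the whole multiplication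
  table. The class -1 is not a root because (-1)^2 + (-1) + 1 = 1, and it is not 1 because f >
  2.\<close>

lemma generate_cubic_root:
  assumes f: "f > 1" "\<not> 3 dvd f" and xy: "x \<in> cubic_roots f" "y \<in> cubic_roots f"
    and inv: "[x * y = 1] (mod int f)"
  shows "{1, x, y} = generate (unit_group f) {x}" "card {1, x, y} = 3"
    "subgroup {1, x, y} (unit_group f)" "(- 1) mod int f \<notin> {1, x, y}"
proof -
  interpret comm_group "unit_group f" by (rule comm_group_unit_group[OF f(1)])
  have xc: "x \<in> carrier (unit_group f)" "y \<in> carrier (unit_group f)"
    using cubic_root_in_unit_group[OF f(1)] xy by auto
  have x1: "x \<noteq> 1" "y \<noteq> 1" using one_notin_cubic_roots[OF f] xy by auto
  have xd: "int f dvd x^2 + x + 1" "int f dvd y^2 + y + 1" using xy by (auto simp: cubic_roots_def)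
  have rng: "0 \<le> x" "x < int f" "0 \<le> y" "y < int f" using xy by (auto simp: cubic_roots_def)
  \<comment> \<open>The product a^3 b is b because a^3 = 1, and it is a^2 because ab = 1.\<close>
  have sq: "[a * a = b] (mod int f)" if "int f dvd a^2 + a + 1" "[a * b = 1] (mod int f)" for a b
  proof -
    have "[a * a * (a * b) = a * a * 1] (mod int f)" by (intro cong_mult cong_refl that)
    moreover have "[a * a * a * b = 1 * b] (mod int f)"
      by (intro cong_mult cong_refl cubic_root_cube that)
    ultimately show ?thesis by (simp add: mult.assoc) (metis cong_sym cong_trans)
  qed
  have xx: "x * x mod int f = y" using sq[OF xd(1) inv] rng by (simp add: cong_def)
  have yy: "y * y mod int f = x" using sq[OF xd(2), of x] inv rng by (simp add: cong_def mult.commute)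
  have xy1: "x * y mod int f = 1" "y * x mod int f = 1"
    using inv f by (simp_all add: cong_def mult.commute)
  have "x \<noteq> y"
  proof
    assume "x = y"
    then have "[x * x = x] (mod int f)" using sq[OF xd(1) inv] by simp
    moreover have "[x * x = 1] (mod int f)" using inv \<open>x = y\<close> by simp
    ultimately have "[x = 1] (mod int f)" by (metis cong_sym cong_trans)
    then show False using x1 rng f by (simp add: cong_def)
  qed
  then show "card {1, x, y} = 3" using x1 by auto
  show sub: "subgroup {1, x, y} (unit_group f)"
  proof (rule finite_subgroupI[OF finite_unit_group[OF f(1)]])
    show "{1, x, y} \<subseteq> carrier (unit_group f)"
      using xc one_closed by (simp add: one_unit_group)
    show "a \<otimes>\<^bsub>unit_group f\<^esub> b \<in> {1, x, y}" if "a \<in> {1, x, y}" "b \<in> {1, x, y}" for a b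
      using that xx yy xy1 rng f by (auto simp: mult_unit_group)
  qed (simp add: one_unit_group)
  show "{1, x, y} = generate (unit_group f) {x}"
  proof
    have "1 \<in> generate (unit_group f) {x}"
      using generate.one[of "unit_group f" "{x}"] by (simp add: one_unit_group)
    moreover have x: "x \<in> generate (unit_group f) {x}" by (simp add: generate.incl)
    moreover have "y \<in> generate (unit_group f) {x}"
      using generate.eng[OF x x] xx by (simp add: mult_unit_group)
    ultimately show "{1, x, y} \<subseteq> generate (unit_group f) {x}" by simp
    show "generate (unit_group f) {x} \<subseteq> {1, x, y}"
      by (rule generate_subgroup_incl[OF _ sub]) simp
  qed
  \<comment> \<open>Modulo 2 the polynomial has no root, its value being odd at 0 and at 1.\<close>
  have f3: "f > 2" using f xd(1) x1 rng by (cases "f = 2") auto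
  show "(- 1) mod int f \<notin> {1, x, y}"
  proof
    assume "(- 1) mod int f \<in> {1, x, y}"
    then consider "(- 1) mod int f = 1" | "(- 1) mod int f \<in> cubic_roots f" using xy by auto
    then show False
    proof cases
      case 1
      then show False using f3 by (simp add: zmod_minus1)
    next
      case 2
      then have "int f dvd ((- 1) mod int f)^2 + (- 1) mod int f + 1" by (simp add: cubic_roots_def)
      \<comment> \<open>The representative of -1 is f-1, and (f-1)^2 + (f-1) + 1 = f(f-1) +
        1.\<close>
      also have "((- 1) mod int f)^2 + (- 1) mod int f + 1 = int f * (int f - 1) + 1"
        using f by (simp add: zmod_minus1 power2_eq_square algebra_simps)
      finally have "int f dvd 1" by (simp add: dvd_add_right_iff)
      then show False using f by simp
    qed
  qed
qed

lemma mod_quot_mult_swap: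
  assumes "f > 0" "int f = loeschian a b" "coprime a b"
  shows "[mod_quot f a b * mod_quot f b a = 1] (mod int f)"
proof -
  have c: "coprime a (int f)" "coprime b (int f)" using coprime_loeschian[OF assms(3,2)] by auto
  have "[(mod_quot f a b * b) * (mod_quot f b a * a) = a * b] (mod int f)"
    by (intro cong_mult mod_quot_cong c)
  then have "[(mod_quot f a b * mod_quot f b a) * (a * b) = 1 * (a * b)] (mod int f)"
    by (simp add: mult_ac)
  moreover have "coprime (a * b) (int f)" using c by simp
  ultimately show ?thesis using cong_mult_rcancel by blast
qed

theorem theorem4p2:
  fixes f :: nat
  assumes "f > 1"
    and "\<And>p :: nat. prime p \<Longrightarrow> p dvd f \<Longrightarrow> [p = 1] (mod 3)"
  shows "card (E_set f) = 2 ^ card (prime_factors f) \<and>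
    (\<forall>x\<in>E_set f. group.ord (unit_group f) x = 3) \<and>
    (\<forall>a b :: int. int f = a^2 + a * b + b^2 \<and> coprime a b \<longrightarrow>
       (let H\<^sub>3 = {1, mod_quot f a b, mod_quot f b a} in
          mod_quot f a b \<in> E_set f \<and>
          H\<^sub>3 = generate (unit_group f) {mod_quot f a b} \<and>
          card H\<^sub>3 = 3 \<and>
          S_mod f H\<^sub>3 =
            real (totient f) / 12 *
              ((\<Prod>p\<in>prime_factors f. 1 + 1 / real p) - 1 / real f) \<and>
          mean_square_L f H\<^sub>3 =
            pi\<^sup>2 / 6 * (real (totient f) / real f) *
              ((\<Prod>p\<in>prime_factors f. 1 + 1 / real p) - 1 / real f)))"
proof -
  have f3: "\<not> 3 dvd f"
  proof
    assume "3 dvd f"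
    then have "[3 = 1] (mod 3 :: nat)" using assms(2)[of 3] by simp
    then show False by (simp add: cong_def)
  qed
  have E: "E_set f = cubic_roots f" by (rule E_set_eq_cubic_roots[OF assms(1)])
  have "card (E_set f) = 2 ^ card (prime_factors f)"
    unfolding E using assms by (intro card_cubic_roots) auto
  moreover have "\<forall>x\<in>E_set f. group.ord (unit_group f) x = 3"
    unfolding E using ord_cubic_root[OF assms(1) f3] by blast
  moreover have "let H\<^sub>3 = {1, mod_quot f a b, mod_quot f b a} in
          mod_quot f a b \<in> E_set f \<and>
          H\<^sub>3 = generate (unit_group f) {mod_quot f a b} \<and>
          card H\<^sub>3 = 3 \<and>
          S_mod f H\<^sub>3 =
            real (totient f) / 12 *
              ((\<Prod>p\<in>prime_factors f. 1 + 1 / real p) - 1 / real f) \<and>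
          mean_square_L f H\<^sub>3 =
            pi\<^sup>2 / 6 * (real (totient f) / real f) *
              ((\<Prod>p\<in>prime_factors f. 1 + 1 / real p) - 1 / real f)"
    if ab: "int f = a^2 + a * b + b^2 \<and> coprime a b" for a b :: int
  proof -
    define x y where "x = mod_quot f a b" and "y = mod_quot f b a"
    have f0: "f > 0" using assms(1) by simp
    have ba: "int f = loeschian b a" "coprime b a"
      using ab by (auto simp: algebra_simps coprime_commute)
    have x: "x \<in> cubic_roots f" and y: "y \<in> cubic_roots f"
      unfolding x_def y_def using mod_quot_cubic_root[OF f0] ab ba by blast+
    have "[x * y = 1] (mod int f)"
      unfolding x_def y_def using ab by (intro mod_quot_mult_swap f0) auto
    note H = generate_cubic_root[OF assms(1) f3 x y this]
    have S: "S_mod f {1, x, y} = real (totient f) / 12 *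
        ((\<Prod>p\<in>prime_factors f. 1 + 1 / real p) - 1 / real f)"
      by (rule S_mod_cubic_roots[OF assms(1) x y H(2)])
    have "mean_square_L f {1, x, y} = 2 * pi\<^sup>2 / real f * S_mod f {1, x, y}"
      by (rule mean_square_L_eq[OF assms(1) H(3,4)])
    also have "\<dots> = pi\<^sup>2 / 6 * (real (totient f) / real f) *
        ((\<Prod>p\<in>prime_factors f. 1 + 1 / real p) - 1 / real f)"
      unfolding S by simp
    finally show ?thesis
      unfolding Let_def x_def[symmetric] y_def[symmetric] using x H(1,2) S E by blast
  qed
  ultimately show ?thesis by blast
qed

end
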